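(* Let $T$ be a plane rooted tree and $\mu$ a $T$-partition of $N$. Then every irreducible $S^\lambda$ contained in the $\mathfrak S_N$-module $S^{T,\mu}$ has a Young diagram with exactly $|T|$ columns, where $|T|$ is the number of nodes of $T$.
   Context: All vector spaces over $\mathbb C$. Let $T$ be a plane rooted tree (arbitrary numbers of children). A $T$-partition of $N$ is a labeling $\mu$ of the nodes of $T$ by positive integers with $\sum_{a\in T}\mu(a)=N$ and $\mu(a)\le\mu(b)$ whenever $a$ is the parent of $b$. A $\mu$-tableau is a filling assigning to each node $a$ a column $Col(a)$ (ordered top to bottom) of $\mu(a)$ distinct positive integers, such that the sets of entries of the columns are disjoint with union $[N]$; $\mathcal T_{T,\mu}$ is the set of $\mu$-tableaux. $M^{T,\mu}$ is the vector space generated by $\mathcal T_{T,\mu}$ subject to column relations $t+s$, where $s$ is obtained from $t$ by switching two entries of the same column; $\bar t$ is the class of $t$. $\mathfrak S_N$ acts by permuting entries. For a non-root node $a$ with parent $p(a)$ and $t\in\mathcal T_{T,\mu}$, the tree Garnir relation of the first kind is $g_a^t=\bar t-\sum_s\bar s$, summing over all $s$ obtained from $t$ by exchanging any entry of $Col(a)$ with the top entry of $Col(p(a))$. Let $G^{T,\mu}$ be the span of all $g_a^t$ and $S^{T,\mu}=M^{T,\mu}/G^{T,\mu}$ (tree Specht module of the first kind). $S^\lambda$ denotes the Specht module. *)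

theory Defs
  imports
    "Jordan_Normal_Form.VS_Connect"
    "HOL-Algebra.AbelCoset"
    "HOL-Library.Disjoint_Sets"
    "HOL-Combinatorics.Permutations"
begin

abbreviation CC :: "complex ring" where
  "CC \<equiv> class_ring"

text \<open>A permutation of \<open>{1..n}\<close> is a function \<open>nat \<Rightarrow> nat\<close> fixing everything outside \<open>{1..n}\<close>.
  The action of a representation is only meaningful on the carrier of its space.\<close>

record 'v sym_rep =
  rep_space :: "(complex, 'v) module"
  rep_act :: "(nat \<Rightarrow> nat) \<Rightarrow> 'v \<Rightarrow> 'v"

abbreviation vspan :: "(complex, 'v) module \<Rightarrow> 'v set \<Rightarrow> 'v set" where
  "vspan V A \<equiv> LinearCombinations.module.span CC V A"

text \<open>For a finite set \<open>X\<close>, the vector space generated by \<open>X\<close> is modelled by the functions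
  \<open>X \<rightarrow> \<complex>\<close>, with basis vectors \<open>basis_vec X x\<close>.  An action \<open>\<alpha>\<close> on \<open>X\<close> is extended linearly,
  i.e. \<open>\<sigma>\<close> sends \<open>basis_vec X x\<close> to \<open>basis_vec X (\<alpha> \<sigma> x)\<close>; this is where the inverse comes from.\<close>

definition perm_rep :: "'x set \<Rightarrow> ((nat \<Rightarrow> nat) \<Rightarrow> 'x \<Rightarrow> 'x) \<Rightarrow> ('x \<Rightarrow> complex) sym_rep" where
  "perm_rep X \<alpha> =
    \<lparr>rep_space = ring.func_space CC X,
     rep_act = (\<lambda>\<sigma> f. restrict (\<lambda>x. f (\<alpha> (inv_into UNIV \<sigma>) x)) X)\<rparr>"

definition basis_vec :: "'x set \<Rightarrow> 'x \<Rightarrow> 'x \<Rightarrow> complex" where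
  "basis_vec X x = restrict (\<lambda>y. if y = x then 1 else 0) X"

text \<open>The quotient by an invariant subspace \<open>W\<close>; its vectors are the cosets of \<open>W\<close>.  The fields
  \<open>mult\<close> and \<open>one\<close> of the library record \<open>module\<close> have no meaning for a vector space.\<close>

definition quotient_rep :: "'v sym_rep \<Rightarrow> 'v set \<Rightarrow> 'v set sym_rep" where
  "quotient_rep V W =
    \<lparr>rep_space =
      \<lparr>carrier = a_rcosets\<^bsub>rep_space V\<^esub> W,
       mult = undefined,
       one = undefined,
       zero = W,
       add = set_add (rep_space V),
       smult = (\<lambda>c A. \<Union>v\<in>A. W +>\<^bsub>rep_space V\<^esub> (c \<odot>\<^bsub>rep_space V\<^esub> v))\<rparr>,
     rep_act = (\<lambda>\<sigma> A. rep_act V \<sigma> ` A)\<rparr>"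

definition restrict_rep :: "'v sym_rep \<Rightarrow> 'v set \<Rightarrow> 'v sym_rep" where
  "restrict_rep V W = V\<lparr>rep_space := (rep_space V)\<lparr>carrier := W\<rparr>\<rparr>"

definition subrep :: "nat \<Rightarrow> 'v sym_rep \<Rightarrow> 'v set \<Rightarrow> bool" where
  "subrep n V W \<longleftrightarrow>
    VectorSpace.subspace CC W (rep_space V) \<and>
    (\<forall>\<sigma> w. \<sigma> permutes {1..n} \<and> w \<in> W \<longrightarrow> rep_act V \<sigma> w \<in> W)"

definition isomorphic_rep :: "nat \<Rightarrow> 'u sym_rep \<Rightarrow> 'v sym_rep \<Rightarrow> bool" where
  "isomorphic_rep n U V \<longleftrightarrow>
    (\<exists>f \<in> LinearCombinations.module_hom CC (rep_space U) (rep_space V).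
      bij_betw f (carrier (rep_space U)) (carrier (rep_space V)) \<and>
      (\<forall>\<sigma> u. \<sigma> permutes {1..n} \<and> u \<in> carrier (rep_space U) \<longrightarrow> f (rep_act U \<sigma> u) = rep_act V \<sigma> (f u)))"

definition contained_in :: "nat \<Rightarrow> 'u sym_rep \<Rightarrow> 'v sym_rep \<Rightarrow> bool" where
  "contained_in n U V \<longleftrightarrow> (\<exists>W. subrep n V W \<and> isomorphic_rep n U (restrict_rep V W))"

definition is_partition :: "nat list \<Rightarrow> nat \<Rightarrow> bool" where
  "is_partition \<nu> n \<longleftrightarrow> sorted_wrt (\<ge>) \<nu> \<and> (\<forall>k \<in> set \<nu>. 0 < k) \<and> sum_list \<nu> = n"

text \<open>Cells are pairs (row, column), both counted from 0.\<close>

definition young_diagram :: "nat list \<Rightarrow> (nat \<times> nat) set" where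
  "young_diagram \<nu> = {(i, j). i < length \<nu> \<and> j < \<nu> ! i}"

definition num_columns :: "nat list \<Rightarrow> nat" where
  "num_columns \<nu> = card (snd ` young_diagram \<nu>)"

text \<open>Only the values of a Young tableau on the cells of the diagram matter.\<close>

definition young_tableaux :: "nat list \<Rightarrow> nat \<Rightarrow> (nat \<times> nat \<Rightarrow> nat) set" where
  "young_tableaux \<nu> n = {t. bij_betw t (young_diagram \<nu>) {1..n}}"

definition row_entries :: "nat list \<Rightarrow> (nat \<times> nat \<Rightarrow> nat) \<Rightarrow> nat \<Rightarrow> nat set" where
  "row_entries \<nu> t i = t ` {c \<in> young_diagram \<nu>. fst c = i}"

definition column_entries :: "nat list \<Rightarrow> (nat \<times> nat \<Rightarrow> nat) \<Rightarrow> nat \<Rightarrow> nat set" where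
  "column_entries \<nu> t j = t ` {c \<in> young_diagram \<nu>. snd c = j}"

text \<open>The tabloid of \<open>t\<close>, i.e. its class modulo reordering entries within rows, is encoded by the
  sequence \<open>row_entries \<nu> t\<close> of its (unordered) rows.\<close>

definition tabloids :: "nat list \<Rightarrow> nat \<Rightarrow> (nat \<Rightarrow> nat set) set" where
  "tabloids \<nu> n = row_entries \<nu> ` young_tableaux \<nu> n"

definition tabloid_rep :: "nat list \<Rightarrow> nat \<Rightarrow> ((nat \<Rightarrow> nat set) \<Rightarrow> complex) sym_rep" where
  "tabloid_rep \<nu> n = perm_rep (tabloids \<nu> n) (\<lambda>\<sigma> r i. \<sigma> ` r i)"

definition column_stabilizer ::
    "nat list \<Rightarrow> nat \<Rightarrow> (nat \<times> nat \<Rightarrow> nat) \<Rightarrow> (nat \<Rightarrow> nat) set" where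
  "column_stabilizer \<nu> n t =
    {\<sigma>. \<sigma> permutes {1..n} \<and> (\<forall>j. \<sigma> ` column_entries \<nu> t j = column_entries \<nu> t j)}"

definition polytabloid ::
    "nat list \<Rightarrow> nat \<Rightarrow> (nat \<times> nat \<Rightarrow> nat) \<Rightarrow> (nat \<Rightarrow> nat set) \<Rightarrow> complex" where
  "polytabloid \<nu> n t =
    (\<Oplus>\<^bsub>rep_space (tabloid_rep \<nu> n)\<^esub> \<sigma> \<in> column_stabilizer \<nu> n t.
       of_int (sign \<sigma>) \<odot>\<^bsub>rep_space (tabloid_rep \<nu> n)\<^esub>
         basis_vec (tabloids \<nu> n) (row_entries \<nu> (\<sigma> \<circ> t)))"

definition specht :: "nat list \<Rightarrow> nat \<Rightarrow> ((nat \<Rightarrow> nat set) \<Rightarrow> complex) sym_rep" where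
  "specht \<nu> n =
    restrict_rep (tabloid_rep \<nu> n)
      (vspan (rep_space (tabloid_rep \<nu> n)) (polytabloid \<nu> n ` young_tableaux \<nu> n))"

text \<open>A node of a plane rooted tree is the sequence of child indices on the path from the root to
  it: the root is \<open>[]\<close>, and the parent of a node \<open>a \<noteq> []\<close> is \<open>butlast a\<close>.\<close>

datatype plane_tree = Node "plane_tree list"

primrec nodes :: "plane_tree \<Rightarrow> nat list set" where
  "nodes (Node ts) = insert [] {i # a | i a. i < length ts \<and> a \<in> map nodes ts ! i}"

definition tree_partition :: "plane_tree \<Rightarrow> (nat list \<Rightarrow> nat) \<Rightarrow> nat \<Rightarrow> bool" where
  "tree_partition T \<mu> N \<longleftrightarrow>
    (\<forall>a \<in> nodes T. 0 < \<mu> a) \<and>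
    (\<Sum>a \<in> nodes T. \<mu> a) = N \<and>
    (\<forall>a \<in> nodes T. a \<noteq> [] \<longrightarrow> \<mu> (butlast a) \<le> \<mu> a)"

text \<open>The list \<open>t a\<close> is the column of the node \<open>a\<close>, read from top to bottom.  The value \<open>[]\<close>
  outside the tree makes a tableau determined by its columns.\<close>

definition tree_tableaux ::
    "plane_tree \<Rightarrow> (nat list \<Rightarrow> nat) \<Rightarrow> nat \<Rightarrow> (nat list \<Rightarrow> nat list) set" where
  "tree_tableaux T \<mu> N =
    {t. (\<forall>a \<in> nodes T. length (t a) = \<mu> a \<and> distinct (t a)) \<and>
        disjoint_family_on (\<lambda>a. set (t a)) (nodes T) \<and>
        (\<Union>a \<in> nodes T. set (t a)) = {1..N} \<and>
        (\<forall>a. a \<notin> nodes T \<longrightarrow> t a = [])}"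

definition permute_entries ::
    "(nat \<Rightarrow> nat) \<Rightarrow> (nat list \<Rightarrow> nat list) \<Rightarrow> nat list \<Rightarrow> nat list" where
  "permute_entries \<sigma> t = (\<lambda>a. map \<sigma> (t a))"

text \<open>All entries of a tableau being distinct, exchanging the entries \<open>x\<close> and \<open>y\<close> means applying
  their transposition to the whole filling.\<close>

abbreviation exchange ::
    "nat \<Rightarrow> nat \<Rightarrow> (nat list \<Rightarrow> nat list) \<Rightarrow> nat list \<Rightarrow> nat list" where
  "exchange x y \<equiv> permute_entries (Transposition.transpose x y)"

definition free_tableau_rep ::
    "plane_tree \<Rightarrow> (nat list \<Rightarrow> nat) \<Rightarrow> nat \<Rightarrow> ((nat list \<Rightarrow> nat list) \<Rightarrow> complex) sym_rep" where
  "free_tableau_rep T \<mu> N = perm_rep (tree_tableaux T \<mu> N) permute_entries"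

definition column_relations ::
    "plane_tree \<Rightarrow> (nat list \<Rightarrow> nat) \<Rightarrow> nat \<Rightarrow> ((nat list \<Rightarrow> nat list) \<Rightarrow> complex) set" where
  "column_relations T \<mu> N =
    {basis_vec (tree_tableaux T \<mu> N) t \<oplus>\<^bsub>rep_space (free_tableau_rep T \<mu> N)\<^esub>
       basis_vec (tree_tableaux T \<mu> N) (exchange x y t) | t a x y.
     t \<in> tree_tableaux T \<mu> N \<and> a \<in> nodes T \<and> x \<in> set (t a) \<and> y \<in> set (t a) \<and> x \<noteq> y}"

definition column_relation_space ::
    "plane_tree \<Rightarrow> (nat list \<Rightarrow> nat) \<Rightarrow> nat \<Rightarrow> ((nat list \<Rightarrow> nat list) \<Rightarrow> complex) set" where
  "column_relation_space T \<mu> N =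
    vspan (rep_space (free_tableau_rep T \<mu> N)) (column_relations T \<mu> N)"

definition M_rep ::
    "plane_tree \<Rightarrow> (nat list \<Rightarrow> nat) \<Rightarrow> nat \<Rightarrow> ((nat list \<Rightarrow> nat list) \<Rightarrow> complex) set sym_rep" where
  "M_rep T \<mu> N = quotient_rep (free_tableau_rep T \<mu> N) (column_relation_space T \<mu> N)"

definition tableau_class ::
    "plane_tree \<Rightarrow> (nat list \<Rightarrow> nat) \<Rightarrow> nat \<Rightarrow> (nat list \<Rightarrow> nat list) \<Rightarrow>
      ((nat list \<Rightarrow> nat list) \<Rightarrow> complex) set" where
  "tableau_class T \<mu> N t =
    column_relation_space T \<mu> N +>\<^bsub>rep_space (free_tableau_rep T \<mu> N)\<^esub>
      basis_vec (tree_tableaux T \<mu> N) t"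

definition garnir ::
    "plane_tree \<Rightarrow> (nat list \<Rightarrow> nat) \<Rightarrow> nat \<Rightarrow> nat list \<Rightarrow> (nat list \<Rightarrow> nat list) \<Rightarrow>
      ((nat list \<Rightarrow> nat list) \<Rightarrow> complex) set" where
  "garnir T \<mu> N a t =
    tableau_class T \<mu> N t \<ominus>\<^bsub>rep_space (M_rep T \<mu> N)\<^esub>
      (\<Oplus>\<^bsub>rep_space (M_rep T \<mu> N)\<^esub> s \<in> {exchange x (hd (t (butlast a))) t | x. x \<in> set (t a)}.
         tableau_class T \<mu> N s)"

definition garnir_space ::
    "plane_tree \<Rightarrow> (nat list \<Rightarrow> nat) \<Rightarrow> nat \<Rightarrow> ((nat list \<Rightarrow> nat list) \<Rightarrow> complex) set set" where
  "garnir_space T \<mu> N =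
    vspan (rep_space (M_rep T \<mu> N))
      {garnir T \<mu> N a t | a t. a \<in> nodes T \<and> a \<noteq> [] \<and> t \<in> tree_tableaux T \<mu> N}"

definition tree_specht ::
    "plane_tree \<Rightarrow> (nat list \<Rightarrow> nat) \<Rightarrow> nat \<Rightarrow>
      ((nat list \<Rightarrow> nat list) \<Rightarrow> complex) set set sym_rep" where
  "tree_specht T \<mu> N = quotient_rep (M_rep T \<mu> N) (garnir_space T \<mu> N)"

end

theory Submission
  imports Defs "HOL-Library.Function_Algebras"
begin

text \<open>If \<open>\<theta>\<close> is an element of the group algebra that does not annihilate the polytabloid \<open>e\<close> of
  some tableau of shape \<open>\<nu>\<close>, then it does not annihilate a module containing the Specht module, so some linear
  functional there is not killed by it.  A functional is a function \<open>F\<close> on tree tableaux that is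
  antisymmetric in every column and satisfies
  \<open>F t = (\<Sum>x \<in> Col a. F (t with x and y exchanged))\<close> whenever \<open>y\<close> lies in the column of the parent
  of \<open>a\<close>.

  If \<open>\<nu>\<close> has too many columns, let \<open>\<theta>\<close> be the row symmetriser: two entries of the first row share a
  column of the tree, so \<open>\<theta> F = 0\<close>.

  If \<open>\<nu>\<close> has too few columns, let \<open>\<theta>\<close> be the signed column sum, and colour each entry by its column
  in the Young tableau.  Since \<open>(x w) (w y) = (w y) (x y)\<close>, the Garnir relations compose along paths,
  so they hold between every node and the root.  Choose distinct non-root nodes \<open>h j\<close>, one for each
  colour \<open>j\<close>, and induct on the number of entries in the columns \<open>h j\<close> with a colour other than \<open>j\<close>:
  if \<open>y\<close> is the top entry of the root and \<open>j\<close> its colour, exchanging \<open>y\<close> with an entry of \<open>h j\<close> of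
  another colour lowers this number, while exchanging it with one of colour \<open>j\<close> changes the sign of
  \<open>\<theta> F\<close>.  Hence \<open>\<theta> F = - q \<cdot> \<theta> F\<close> with \<open>q \<ge> 0\<close>, and \<open>\<theta> F = 0\<close>.\<close>

section \<open>Representations and their quotients\<close>

text \<open>\<open>act_inverse\<close> is the axiom taken from the group structure. It makes every
  permutation map an invariant subspace onto itself, so that images of cosets are again
  cosets.\<close>

locale linear_rep =
  fixes n :: nat and E :: "'v sym_rep"
  assumes is_module: "module CC (rep_space E)"
    and act_closed: "\<sigma> permutes {1..n} \<Longrightarrow> v \<in> carrier (rep_space E) \<Longrightarrow>
      rep_act E \<sigma> v \<in> carrier (rep_space E)"
    and act_add: "\<sigma> permutes {1..n} \<Longrightarrow> v \<in> carrier (rep_space E) \<Longrightarrow> w \<in> carrier (rep_space E) \<Longrightarrow>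
      rep_act E \<sigma> (v \<oplus>\<^bsub>rep_space E\<^esub> w) = rep_act E \<sigma> v \<oplus>\<^bsub>rep_space E\<^esub> rep_act E \<sigma> w"
    and act_smult: "\<sigma> permutes {1..n} \<Longrightarrow> v \<in> carrier (rep_space E) \<Longrightarrow>
      rep_act E \<sigma> (c \<odot>\<^bsub>rep_space E\<^esub> v) = c \<odot>\<^bsub>rep_space E\<^esub> rep_act E \<sigma> v"
    and act_inverse: "\<sigma> permutes {1..n} \<Longrightarrow> v \<in> carrier (rep_space E) \<Longrightarrow>
      rep_act E \<sigma> (rep_act E (inv_into UNIV \<sigma>) v) = v"
begin

sublocale V: Module.module CC "rep_space E"
  by (rule is_module)

lemma act_mod_hom:
  assumes "\<sigma> permutes {1..n}"
  shows "mod_hom CC (rep_space E) (rep_space E) (rep_act E \<sigma>)"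
  using assms is_module
  by (auto simp: mod_hom_def mod_hom_axioms_def LinearCombinations.module_hom_def
      act_closed act_add act_smult simp del: One_nat_def)

text \<open>The preimage of the span under the linear map \<open>rep_act E \<sigma>\<close> is a
  submodule containing \<open>A\<close>, hence it contains the span.\<close>

lemma span_invariant:
  assumes A: "A \<subseteq> carrier (rep_space E)" and \<sigma>: "\<sigma> permutes {1..n}"
    and inv: "\<And>v. v \<in> A \<Longrightarrow> rep_act E \<sigma> v \<in> A"
    and w: "w \<in> vspan (rep_space E) A"
  shows "rep_act E \<sigma> w \<in> vspan (rep_space E) A"
proof -
  interpret h: mod_hom CC "rep_space E" "rep_space E" "rep_act E \<sigma>"
    using \<sigma> by (rule act_mod_hom)
  let ?S = "vspan (rep_space E) A"
  interpret S: submodule CC ?S "rep_space E"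
    using A by (rule V.span_is_submodule)
  let ?N = "{v \<in> carrier (rep_space E). rep_act E \<sigma> v \<in> ?S}"
  have "submodule CC ?N (rep_space E)"
    by unfold_locales auto
  moreover have "A \<subseteq> ?N"
    using A inv V.in_own_span[OF A] by auto
  ultimately have "?S \<subseteq> ?N"
    using V.span_is_subset by blast
  with w show ?thesis by auto
qed

end

text \<open>The axioms pass to the image under any map \<open>p\<close> compatible with the
  operations. Applied to the coset map, this replaces a direct verification of the module axioms for
  set-valued operations.\<close>

lemma linear_rep_image:
  assumes E: "linear_rep n E"
    and carr: "carrier (rep_space F) = p ` carrier (rep_space E)"
    and add: "\<And>v w. v \<in> carrier (rep_space E) \<Longrightarrow> w \<in> carrier (rep_space E) \<Longrightarrow>
      p v \<oplus>\<^bsub>rep_space F\<^esub> p w = p (v \<oplus>\<^bsub>rep_space E\<^esub> w)"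
    and zero: "\<zero>\<^bsub>rep_space F\<^esub> = p \<zero>\<^bsub>rep_space E\<^esub>"
    and smult: "\<And>c v. v \<in> carrier (rep_space E) \<Longrightarrow>
      c \<odot>\<^bsub>rep_space F\<^esub> p v = p (c \<odot>\<^bsub>rep_space E\<^esub> v)"
    and act: "\<And>\<sigma> v. \<sigma> permutes {1..n} \<Longrightarrow> v \<in> carrier (rep_space E) \<Longrightarrow>
      rep_act F \<sigma> (p v) = p (rep_act E \<sigma> v)"
  shows "linear_rep n F"
proof -
  interpret linear_rep n E by fact
  have ring: "cring CC" by unfold_locales
  have smult_rules: "(a + b) \<odot>\<^bsub>rep_space E\<^esub> v =
        a \<odot>\<^bsub>rep_space E\<^esub> v \<oplus>\<^bsub>rep_space E\<^esub> b \<odot>\<^bsub>rep_space E\<^esub> v"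
      "(a * b) \<odot>\<^bsub>rep_space E\<^esub> v = a \<odot>\<^bsub>rep_space E\<^esub> (b \<odot>\<^bsub>rep_space E\<^esub> v)"
      "1 \<odot>\<^bsub>rep_space E\<^esub> v = v"
    if "v \<in> carrier (rep_space E)" for a b v
    using that V.smult_l_distr[of a b v] V.smult_assoc1[of a b v] V.smult_one[of v] by simp_all
  have "module CC (rep_space F)"
  proof (rule module_criteria[OF ring])
    show "\<forall>v\<in>carrier (rep_space F). \<exists>w\<in>carrier (rep_space F). v \<oplus>\<^bsub>rep_space F\<^esub> w = \<zero>\<^bsub>rep_space F\<^esub>"
      unfolding carr
    proof (safe)
      fix v assume "v \<in> carrier (rep_space E)"
      then show "\<exists>w\<in>p ` carrier (rep_space E). p v \<oplus>\<^bsub>rep_space F\<^esub> w = \<zero>\<^bsub>rep_space F\<^esub>"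
        by (intro bexI[of _ "p (\<ominus>\<^bsub>rep_space E\<^esub> v)"]) (auto simp: add zero V.M.r_neg)
    qed
  qed (auto simp: carr add zero smult smult_rules V.smult_r_distr V.M.a_ac)
  then show ?thesis
  proof (intro linear_rep.intro)
  qed (auto simp: carr add smult act act_closed act_add act_smult act_inverse permutes_inv
      simp del: One_nat_def)
qed

section \<open>The quotient by an invariant subspace\<close>

locale invariant_subspace = linear_rep +
  fixes W
  assumes submodule: "submodule CC W (rep_space E)"
    and invariant: "\<sigma> permutes {1..n} \<Longrightarrow> w \<in> W \<Longrightarrow> rep_act E \<sigma> w \<in> W"
begin

sublocale W: submodule CC W "rep_space E"
  by (rule submodule)

sublocale W: abelian_subgroup W "rep_space E"
proof (rule abelian_subgroupI3)
  show "additive_subgroup W (rep_space E)"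
  proof (rule additive_subgroupI, rule V.M.add.subgroupI)
    show "\<ominus>\<^bsub>rep_space E\<^esub> a \<in> W" if "a \<in> W" for a
    proof -
      have "\<ominus>\<^bsub>rep_space E\<^esub> a = (- 1) \<odot>\<^bsub>rep_space E\<^esub> a"
        using that W.subset V.smult_minus_1[of a]
        by (auto simp: subset_iff class_ring_simps)
      then show ?thesis using that by simp
    qed
  qed (use W.subset in \<open>auto intro: W.zero_closed\<close>)
qed unfold_locales

abbreviation proj :: "'a \<Rightarrow> 'a set" where
  "proj v \<equiv> W +>\<^bsub>rep_space E\<^esub> v"

text \<open>Acting with the inverse permutation gives a preimage in \<open>W\<close> of each element
  of \<open>W\<close>, so \<sigma> maps \<open>W\<close> onto itself. Hence taking images of cosets
  is a well-defined action on the quotient.\<close>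

lemma proj_act:
  assumes \<sigma>: "\<sigma> permutes {1..n}" and v: "v \<in> carrier (rep_space E)"
  shows "rep_act E \<sigma> ` proj v = proj (rep_act E \<sigma> v)"
proof -
  have "rep_act E \<sigma> ` W = W"
  proof
    show "W \<subseteq> rep_act E \<sigma> ` W"
    proof
      fix w assume "w \<in> W"
      then have "w = rep_act E \<sigma> (rep_act E (inv_into UNIV \<sigma>) w)"
          "rep_act E (inv_into UNIV \<sigma>) w \<in> W"
        using act_inverse[OF \<sigma>] invariant[OF permutes_inv[OF \<sigma>]] W.subset by auto
      then show "w \<in> rep_act E \<sigma> ` W" by blast
    qed
  qed (use invariant \<sigma> in auto)
  then have "proj (rep_act E \<sigma> v) = (\<Union>h\<in>W. {rep_act E \<sigma> h \<oplus>\<^bsub>rep_space E\<^esub> rep_act E \<sigma> v})"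
    unfolding a_r_coset_def' by (metis (no_types, lifting) SUP_image comp_apply SUP_cong)
  also have "\<dots> = rep_act E \<sigma> ` proj v"
    unfolding a_r_coset_def' using W.subset act_add[OF \<sigma>] v by (auto simp: subset_iff image_UN)
  finally show ?thesis ..
qed

text \<open>Scalar multiplication in \<open>quotient_rep\<close> is a union over all
  representatives. It collapses to one coset because representatives differ by elements of
  \<open>W\<close>, which is closed under scalars.\<close>

lemma proj_smult:
  assumes v: "v \<in> carrier (rep_space E)"
  shows "(\<Union>x\<in>proj v. proj (c \<odot>\<^bsub>rep_space E\<^esub> x)) = proj (c \<odot>\<^bsub>rep_space E\<^esub> v)"
proof -
  have "proj (c \<odot>\<^bsub>rep_space E\<^esub> x) = proj (c \<odot>\<^bsub>rep_space E\<^esub> v)" if "x \<in> proj v" for x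
  proof -
    from that obtain w where w: "w \<in> W" "x = w \<oplus>\<^bsub>rep_space E\<^esub> v"
      by (auto simp: a_r_coset_def')
    then have *: "w \<in> carrier (rep_space E)" using W.subset by auto
    then have "c \<odot>\<^bsub>rep_space E\<^esub> x = c \<odot>\<^bsub>rep_space E\<^esub> w \<oplus>\<^bsub>rep_space E\<^esub> c \<odot>\<^bsub>rep_space E\<^esub> v"
      using v w by (simp add: V.smult_r_distr)
    then have "c \<odot>\<^bsub>rep_space E\<^esub> x \<in> proj (c \<odot>\<^bsub>rep_space E\<^esub> v)"
      using w(1) by (auto simp: a_r_coset_def')
    then show ?thesis
      using V.M.a_repr_independence[OF _ _ W.a_subgroup] v by (simp add: class_ring_simps)
  qed
  moreover have "v \<in> proj v" using v by (rule W.a_rcos_self)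
  ultimately show ?thesis by blast
qed

lemma carrier_quotient:
  "carrier (rep_space (quotient_rep E W)) = proj ` carrier (rep_space E)"
  by (auto simp: quotient_rep_def A_RCOSETS_def')

lemma linear_rep_quotient: "linear_rep n (quotient_rep E W)"
proof (rule linear_rep_image[where p = proj, OF linear_rep_axioms carrier_quotient])
  show "\<zero>\<^bsub>rep_space (quotient_rep E W)\<^esub> = proj \<zero>\<^bsub>rep_space E\<^esub>"
    by (simp add: quotient_rep_def W.a_subset)
qed (simp_all add: quotient_rep_def W.a_rcos_sum proj_smult proj_act del: One_nat_def)

lemma act_quotient:
  assumes "\<sigma> permutes {1..n}" "v \<in> carrier (rep_space E)"
  shows "rep_act (quotient_rep E W) \<sigma> (proj v) = proj (rep_act E \<sigma> v)"
  using proj_act[OF assms] by (simp add: quotient_rep_def)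

lemma proj_mod_hom: "mod_hom CC (rep_space E) (rep_space (quotient_rep E W)) proj"
proof -
  interpret Q: linear_rep n "quotient_rep E W" by (rule linear_rep_quotient)
  show ?thesis
    unfolding mod_hom_def mod_hom_axioms_def LinearCombinations.module_hom_def
    using is_module Q.is_module
    by (auto simp: carrier_quotient) (simp_all add: quotient_rep_def W.a_rcos_sum proj_smult)
qed

lemma proj_eq_zero: "w \<in> W \<Longrightarrow> proj w = \<zero>\<^bsub>rep_space (quotient_rep E W)\<^esub>"
  using W.subset V.M.a_coset_join2[OF _ W.a_subgroup] by (auto simp: quotient_rep_def)

end

section \<open>Spaces of functions on a finite set\<close>

lemma cring_CC: "cring CC"
  by unfold_locales

lemma ring_CC: "ring CC"
  by unfold_locales

lemma module_func_space: "Module.module CC (ring.func_space CC X)"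
  by (rule cring.func_space_is_module[OF cring_CC])

lemma func_space_simps [simp]:
  "carrier (ring.func_space CC X) = X \<rightarrow>\<^sub>E UNIV"
  "\<zero>\<^bsub>ring.func_space CC X\<^esub> = restrict (\<lambda>x. 0) X"
  "f \<oplus>\<^bsub>ring.func_space CC X\<^esub> g = restrict (\<lambda>x. f x + g x) X"
  "c \<odot>\<^bsub>ring.func_space CC X\<^esub> f = restrict (\<lambda>x. c * f x) X"
  by (simp_all add: ring.func_space_def[OF ring_CC])

lemma func_space_finsum:
  assumes "f \<in> S \<rightarrow> carrier (ring.func_space CC X)" "x \<in> X"
  shows "finsum (ring.func_space CC X) f S x = (\<Sum>s\<in>S. f s x)"
proof -
  interpret Module.module CC "ring.func_space CC X" by (rule module_func_space)
  show ?thesis using assms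
    by (induction S rule: infinite_finite_induct) auto
qed

text \<open>Subtraction is given through the abstract group inverse, so its value is read off after
  adding \<open>g\<close> back.\<close>

lemma func_space_minus:
  assumes "f \<in> carrier (ring.func_space CC X)" "g \<in> carrier (ring.func_space CC X)" "x \<in> X"
  shows "(f \<ominus>\<^bsub>ring.func_space CC X\<^esub> g) x = f x - g x"
proof -
  interpret Module.module CC "ring.func_space CC X" by (rule module_func_space)
  have "(f \<ominus>\<^bsub>ring.func_space CC X\<^esub> g) \<oplus>\<^bsub>ring.func_space CC X\<^esub> g = f"
    using assms(1,2) by (simp only: M.minus_eq M.a_assoc M.l_neg M.r_zero M.a_inv_closed)
  then have "((f \<ominus>\<^bsub>ring.func_space CC X\<^esub> g) \<oplus>\<^bsub>ring.func_space CC X\<^esub> g) x = f x" by simp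
  then show ?thesis using assms(3) by (simp add: eq_diff_eq)
qed

lemma basis_vec_closed [simp]: "basis_vec X x \<in> X \<rightarrow>\<^sub>E UNIV"
  by (simp add: basis_vec_def)

lemma sum_mult_basis_vec:
  assumes "finite X" "t \<in> X"
  shows "(\<Sum>x\<in>X. \<phi> x * basis_vec X t x) = \<phi> t"
  using assms by (simp add: basis_vec_def if_distrib[of "\<lambda>c. _ * c"] sum.delta cong: if_cong)

section \<open>Linear representations from actions on sets\<close>

locale perm_action =
  fixes n :: nat and X :: "'x set" and \<alpha> :: "(nat \<Rightarrow> nat) \<Rightarrow> 'x \<Rightarrow> 'x"
  assumes closed: "\<sigma> permutes {1..n} \<Longrightarrow> x \<in> X \<Longrightarrow> \<alpha> \<sigma> x \<in> X"
    and inverse: "\<sigma> permutes {1..n} \<Longrightarrow> x \<in> X \<Longrightarrow> \<alpha> (inv_into UNIV \<sigma>) (\<alpha> \<sigma> x) = x"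
begin

lemma inverse': "\<sigma> permutes {1..n} \<Longrightarrow> x \<in> X \<Longrightarrow> \<alpha> \<sigma> (\<alpha> (inv_into UNIV \<sigma>) x) = x"
  using inverse[OF permutes_inv, of \<sigma> x] by (simp add: permutes_inv_inv)

lemma bij_betw_action:
  assumes "\<sigma> permutes {1..n}"
  shows "bij_betw (\<alpha> \<sigma>) X X"
  using closed[OF assms] closed[OF permutes_inv[OF assms]] inverse[OF assms] inverse'[OF assms]
  by (intro bij_betw_byWitness[of _ "\<alpha> (inv_into UNIV \<sigma>)"]) auto

sublocale linear_rep n "perm_rep X \<alpha>"
proof (rule linear_rep.intro)
  show "Module.module CC (rep_space (perm_rep X \<alpha>))"
    by (simp add: perm_rep_def module_func_space)
next
  fix \<sigma> v assume \<sigma>: "\<sigma> permutes {1..n}" and v: "v \<in> carrier (rep_space (perm_rep X \<alpha>))"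
  show "rep_act (perm_rep X \<alpha>) \<sigma> (rep_act (perm_rep X \<alpha>) (inv_into UNIV \<sigma>) v) = v"
  proof
    fix x
    show "rep_act (perm_rep X \<alpha>) \<sigma> (rep_act (perm_rep X \<alpha>) (inv_into UNIV \<sigma>) v) x = v x"
      using v closed[OF permutes_inv[OF \<sigma>]] inverse'[OF \<sigma>]
      by (cases "x \<in> X") (auto simp: perm_rep_def permutes_inv_inv[OF \<sigma>] PiE_def extensional_def)
  qed
qed (use closed[OF permutes_inv] in \<open>auto simp: perm_rep_def fun_eq_iff restrict_def simp del: One_nat_def\<close>)

lemma act_basis_vec:
  assumes \<sigma>: "\<sigma> permutes {1..n}" and "t \<in> X"
  shows "rep_act (perm_rep X \<alpha>) \<sigma> (basis_vec X t) = basis_vec X (\<alpha> \<sigma> t)"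
proof -
  have "\<alpha> (inv_into UNIV \<sigma>) x = t \<longleftrightarrow> x = \<alpha> \<sigma> t" if "x \<in> X" for x
    using inverse[OF \<sigma> \<open>t \<in> X\<close>] inverse'[OF \<sigma> that] by auto
  then show ?thesis
    using closed[OF permutes_inv[OF \<sigma>]]
    by (auto simp: perm_rep_def basis_vec_def restrict_def fun_eq_iff)
qed

text \<open>Substituting \<open>\<alpha> \<sigma> x\<close> for \<open>x\<close> cancels the inverse
  in \<open>perm_rep\<close>: the action is moved from the vector \<open>v\<close> onto the
  functional \<phi>.\<close>

lemma sum_mult_act:
  assumes "\<sigma> permutes {1..n}"
  shows "(\<Sum>x\<in>X. \<phi> x * rep_act (perm_rep X \<alpha>) \<sigma> v x) = (\<Sum>x\<in>X. \<phi> (\<alpha> \<sigma> x) * v x)"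
  using sum.reindex_bij_betw[OF bij_betw_action[OF assms],
      of "\<lambda>x. \<phi> x * rep_act (perm_rep X \<alpha>) \<sigma> v x"] closed[OF assms] inverse[OF assms]
  by (simp add: perm_rep_def)

end

text \<open>A basis of the subspace stays independent when \<open>v\<close> is added, so some linear
  map is 0 on that basis and 1 at \<open>v\<close>. Finiteness of \<open>X\<close> turns this map
  into the pairing with a function.\<close>

lemma separating_functional:
  assumes X: "finite X" and W: "submodule CC W (ring.func_space CC X)"
    and v: "v \<in> X \<rightarrow>\<^sub>E UNIV" "v \<notin> W"
  obtains \<phi> where "\<And>w. w \<in> W \<Longrightarrow> (\<Sum>x\<in>X. \<phi> x * w x) = 0" "(\<Sum>x\<in>X. \<phi> x * v x) \<noteq> (0 :: complex)"
proof -
  \<comment> \<open>Scalars act on total functions here, so that the class-based theory of vector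
    spaces applies.\<close>
  define s where "s = (\<lambda>(c :: complex) (f :: 'a \<Rightarrow> complex) x. c * f x)"
  interpret vector_space_pair s "(*)"
    by unfold_locales (auto simp: s_def fun_eq_iff algebra_simps)
  interpret W: submodule CC W "ring.func_space CC X" by (rule W)
  \<comment> \<open>The preimage of \<open>W\<close> under restriction to \<open>X\<close>; it
    contains every function that vanishes on \<open>X\<close>.\<close>
  define W' where "W' = {f. restrict f X \<in> W}"
  have add: "f + g \<in> W'" if "f \<in> W'" "g \<in> W'" for f g
    using W.m_closed[of "restrict f X" "restrict g X"] that by (simp add: W'_def restrict_def cong: if_cong)
  have sub: "vs1.subspace W'"
  proof (rule vs1.subspaceI)
    show "s c f \<in> W'" if "f \<in> W'" for c f
      using W.smult_closed[of c "restrict f X"] that by (simp add: W'_def s_def restrict_def cong: if_cong)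
    show "0 \<in> W'" using W.zero_closed by (simp add: W'_def zero_fun_def)
  qed (rule add)
  obtain B where B: "B \<subseteq> W'" "vs1.independent B" "W' \<subseteq> vs1.span B"
      and "card B = vs1.dim W'"
    by (rule vs1.basis_exists)
  have "v \<notin> W'" using v by (simp add: W'_def PiE_restrict)
  moreover have "vs1.span B \<subseteq> W'" using B(1) sub by (rule vs1.span_minimal)
  ultimately have vB: "v \<notin> vs1.span B" "v \<notin> B" using B(1) by auto
  then have "vs1.independent (insert v B)" using B(2) by (simp add: vs1.independent_insert)
  then obtain g where g: "Vector_Spaces.linear s (*) g" "\<And>x. x \<in> insert v B \<Longrightarrow> g x = (if x = v then 1 else 0)"
    using linear_independent_extend[of "insert v B" "\<lambda>x. if x = v then 1 else 0"] by blast
  interpret g: Vector_Spaces.linear s "(*)" g by (rule g(1))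
  have "g w = 0" if "w \<in> W'" for w
    using g.eq_0_on_span[of B w] B(3) that g(2) vB(2) by (metis insertI2 subsetD)
  define \<phi> where "\<phi> x = g (\<lambda>y. if y = x then 1 else 0)" for x
  have expand: "(\<Sum>x\<in>X. \<phi> x * w x) = g w" for w
  proof -
    let ?u = "\<Sum>x\<in>X. s (w x) (\<lambda>y. if y = x then 1 else 0)"
    have sum_apply: "(\<Sum>x\<in>S. h x) y = (\<Sum>x\<in>S. h x y)" for h :: "'a \<Rightarrow> 'a \<Rightarrow> complex" and S y
      by (induction S rule: infinite_finite_induct) auto
    have u: "?u = (\<lambda>y. if y \<in> X then w y else 0)"
      using X by (auto simp: fun_eq_iff sum_apply s_def if_distrib sum.delta' cong: if_cong)
    \<comment> \<open>\<open>?u\<close> agrees with \<open>w\<close> on \<open>X\<close>, so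
      \<open>g\<close> takes the same value on both.\<close>
    have "w - ?u \<in> W'"
      using W.zero_closed unfolding u W'_def by (simp add: restrict_def cong: if_cong)
    then have "g (w - ?u) = 0" by fact
    then have "g w = g ?u" by (simp add: g.diff)
    also have "\<dots> = (\<Sum>x\<in>X. \<phi> x * w x)"
      by (simp add: g.sum g.scale \<phi>_def mult.commute)
    finally show ?thesis ..
  qed
  show thesis
  proof
    show "(\<Sum>x\<in>X. \<phi> x * w x) = 0" if "w \<in> W" for w
    proof -
      have "restrict w X = w" using that W.subset by (auto intro: PiE_restrict)
      then show ?thesis
        using that \<open>\<And>w. w \<in> W' \<Longrightarrow> g w = 0\<close> expand by (simp add: W'_def)
    qed
    show "(\<Sum>x\<in>X. \<phi> x * v x) \<noteq> 0" using g(2)[of v] expand by simp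
  qed
qed

section \<open>Tree tableaux\<close>

lemma nodes_Node: "nodes (Node ts) = insert [] (\<Union>i<length ts. (#) i ` nodes (ts ! i))"
  by auto

lemma finite_nodes: "finite (nodes T)"
  by (induction T) (simp add: nodes_Node del: nodes.simps)

lemma Nil_in_nodes [simp]: "[] \<in> nodes T"
  by (cases T) simp

lemma butlast_in_nodes: "a \<in> nodes T \<Longrightarrow> butlast a \<in> nodes T"
proof (induction T arbitrary: a)
  case (Node ts)
  then show ?case
  proof (cases "length a \<le> 1")
    case True
    then have "butlast a = []" by (simp add: butlast_conv_take)
    then show ?thesis by simp
  next
    case False
    then obtain i b where ib: "a = i # b" "b \<noteq> []" by (cases a) auto
    with Node show ?thesis by auto
  qed
qed

lemma transpose_permutes: "x \<in> S \<Longrightarrow> y \<in> S \<Longrightarrow> Transposition.transpose x y permutes S"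
  by (rule permutes_swap_id)

lemma comp_transpose:
  assumes "inj \<sigma>"
  shows "\<sigma> \<circ> Transposition.transpose x y = Transposition.transpose (\<sigma> x) (\<sigma> y) \<circ> \<sigma>"
  using assms by (auto simp: fun_eq_iff Transposition.transpose_def inj_eq)

lemma permute_entries_comp:
  "permute_entries \<sigma> (permute_entries \<tau> t) = permute_entries (\<sigma> \<circ> \<tau>) t"
  by (simp add: permute_entries_def)

lemma set_permute_entries: "set (permute_entries \<sigma> t a) = \<sigma> ` set (t a)"
  by (simp add: permute_entries_def)

text \<open>Conjugating a transposition by \<sigma> relabels its two entries. The invariance of the
  column and Garnir relations rests on this.\<close>

lemma permute_exchange:
  "inj \<sigma> \<Longrightarrow> permute_entries \<sigma> (exchange x y t) = exchange (\<sigma> x) (\<sigma> y) (permute_entries \<sigma> t)"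
  by (simp add: permute_entries_comp comp_transpose)

locale tree_shape =
  fixes T :: plane_tree and \<mu> :: "nat list \<Rightarrow> nat" and N :: nat
  assumes tree_partition: "tree_partition T \<mu> N"
begin

abbreviation tabs :: "(nat list \<Rightarrow> nat list) set" where
  "tabs \<equiv> tree_tableaux T \<mu> N"

lemma finite_tabs: "finite tabs"
proof (rule finite_subset)
  show "tabs \<subseteq> {t. \<forall>a. (a \<in> nodes T \<longrightarrow> t a \<in> (\<Union>b\<in>nodes T. {xs. set xs \<subseteq> {1..N} \<and> length xs = \<mu> b})) \<and>
      (a \<notin> nodes T \<longrightarrow> t a = [])}"
    unfolding tree_tableaux_def by blast
  show "finite \<dots>"
    by (intro finite_set_of_finite_funs finite_nodes finite_UN_I finite_lists_length_eq) simp
qed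

lemma entry_in_range: "t \<in> tabs \<Longrightarrow> a \<in> nodes T \<Longrightarrow> x \<in> set (t a) \<Longrightarrow> x \<in> {1..N}"
  unfolding tree_tableaux_def by blast

lemma same_column:
  "t \<in> tabs \<Longrightarrow> a \<in> nodes T \<Longrightarrow> b \<in> nodes T \<Longrightarrow> x \<in> set (t a) \<Longrightarrow> x \<in> set (t b) \<Longrightarrow> a = b"
  unfolding tree_tableaux_def disjoint_family_on_def by blast

lemma hd_in_column:
  assumes "t \<in> tabs" "a \<in> nodes T"
  shows "hd (t a) \<in> set (t a)"
proof -
  have "length (t a) > 0"
    using assms tree_partition by (auto simp: tree_tableaux_def tree_partition_def)
  then show ?thesis by simp
qed

lemma permute_in_tabs:
  assumes \<sigma>: "\<sigma> permutes {1..N}" and t: "t \<in> tabs"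
  shows "permute_entries \<sigma> t \<in> tabs"
proof -
  have inj: "inj \<sigma>" using \<sigma> by (rule permutes_inj)
  have "(\<Union>a\<in>nodes T. set (t a)) = {1..N}"
    using t by (simp add: tree_tableaux_def)
  then have "(\<Union>a\<in>nodes T. \<sigma> ` set (t a)) = \<sigma> ` {1..N}"
    by (metis image_UN)
  moreover have "disjoint_family_on (\<lambda>a. \<sigma> ` set (t a)) (nodes T)"
    using t inj by (auto simp: tree_tableaux_def disjoint_family_on_def image_Int[symmetric])
  ultimately show ?thesis
    using t inj permutes_image[OF \<sigma>]
    by (auto simp: tree_tableaux_def permute_entries_def distinct_map simp del: One_nat_def intro: inj_on_subset[OF _ subset_UNIV])
qed

lemma exchange_in_tabs:
  "t \<in> tabs \<Longrightarrow> x \<in> {1..N} \<Longrightarrow> y \<in> {1..N} \<Longrightarrow> exchange x y t \<in> tabs"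
  by (intro permute_in_tabs transpose_permutes)

lemma set_exchange_other:
  assumes "t \<in> tabs" "a \<in> nodes T" "b \<in> nodes T" "c \<in> nodes T" "x \<in> set (t a)" "y \<in> set (t b)"
    "c \<noteq> a" "c \<noteq> b"
  shows "set (exchange x y t c) = set (t c)"
proof -
  have "x \<notin> set (t c)" "y \<notin> set (t c)" using same_column assms by metis+
  then show ?thesis by (auto simp: set_permute_entries Transposition.transpose_def image_iff)
qed

end

text \<open>Conjugating the transposition of \<open>y\<close> and \<open>z\<close> by that of
  \<open>x\<close> and \<open>y\<close> gives that of \<open>x\<close> and \<open>z\<close>. This is
  how two successive exchanges are rewritten below.\<close>

lemma transpose_triple:
  "x \<noteq> y \<Longrightarrow> x \<noteq> z \<Longrightarrow> y \<noteq> z \<Longrightarrow>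
    Transposition.transpose x y \<circ> Transposition.transpose y z =
    Transposition.transpose x z \<circ> Transposition.transpose x y"
  by (auto simp: fun_eq_iff Transposition.transpose_def)

section \<open>Functions satisfying the column and Garnir relations\<close>

locale garnir_function = tree_shape +
  fixes F :: "(nat list \<Rightarrow> nat list) \<Rightarrow> complex"
  assumes antisym: "t \<in> tabs \<Longrightarrow> a \<in> nodes T \<Longrightarrow> x \<in> set (t a) \<Longrightarrow> y \<in> set (t a) \<Longrightarrow> x \<noteq> y \<Longrightarrow>
      F (exchange x y t) = - F t"
    and garnir_top: "t \<in> tabs \<Longrightarrow> a \<in> nodes T \<Longrightarrow> a \<noteq> [] \<Longrightarrow>
      F t = (\<Sum>x\<in>set (t a). F (exchange x (hd (t (butlast a))) t))"
begin

text \<open>Bringing \<open>y\<close> to the top of the parent column negates both sides of the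
  relation, by antisymmetry in that column. So the relation for the top entry yields the one for
  \<open>y\<close>.\<close>

lemma garnir_parent:
  assumes t: "t \<in> tabs" and a: "a \<in> nodes T" "a \<noteq> []" and y: "y \<in> set (t (butlast a))"
  shows "F t = (\<Sum>x\<in>set (t a). F (exchange x y t))"
proof (cases "y = hd (t (butlast a))")
  case True
  then show ?thesis using garnir_top[OF t a] by simp
next
  case False
  define p where "p = butlast a"
  define z where "z = hd (t p)"
  have p: "p \<in> nodes T" "p \<noteq> a"
    using a butlast_in_nodes by (auto simp: p_def) (metis append_butlast_last_id append_self_conv not_Cons_self2)
  have z: "z \<in> set (t p)" unfolding z_def using t p(1) by (rule hd_in_column)
  have ypz: "y \<in> set (t p)" "y \<noteq> z" using y False by (auto simp: p_def z_def)
  note range = entry_in_range[OF t p(1) ypz(1)] entry_in_range[OF t p(1) z]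
  \<comment> \<open>The tableau with \<open>y\<close> brought to the top of the parent
    column.\<close>
  define t' where "t' = exchange y z t"
  have t': "t' \<in> tabs" unfolding t'_def using t range by (intro exchange_in_tabs)
  have hd: "hd (t' p) = y"
    using z by (cases "t p") (auto simp: t'_def z_def permute_entries_def)
  have set_a: "set (t' a) = set (t a)"
    unfolding t'_def using t p a z ypz by (intro set_exchange_other[of _ p p]) auto
  have "F (exchange x y t') = - F (exchange x y t)" if x: "x \<in> set (t a)" for x
  proof -
    have neq: "x \<noteq> y" "x \<noteq> z" using same_column[OF t p(1) a(1)] x ypz z p by auto
    have "exchange x y t' = exchange x z (exchange x y t)"
      unfolding t'_def permute_entries_comp transpose_triple[OF neq ypz(2)] ..
    moreover have "exchange x y t \<in> tabs"
      using t x a range by (intro exchange_in_tabs entry_in_range[OF t a(1) x])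
    \<comment> \<open>After the exchange, \<open>x\<close> has joined \<open>z\<close> in the parent
      column, so exchanging these two costs a sign.\<close>
    moreover have "x \<in> set (exchange x y t p)" "z \<in> set (exchange x y t p)"
      using ypz z neq by (auto simp: set_permute_entries image_iff Transposition.transpose_def)
    ultimately show ?thesis using antisym[of "exchange x y t" p x z] p neq by simp
  qed
  then have "F t' = - (\<Sum>x\<in>set (t a). F (exchange x y t))"
    using garnir_top[OF t' a] hd set_a by (simp add: p_def[symmetric] sum_negf)
  moreover have "F t' = - F t"
    unfolding t'_def using t p ypz z by (intro antisym)
  ultimately show ?thesis by simp
qed

text \<open>Each summand is expanded by the relation between \<open>p\<close> and \<open>q\<close>.
  Rewriting the two exchanges and interchanging the sums lets the relation between \<open>a\<close>
  and \<open>p\<close> collapse the inner sum, and the relation between \<open>p\<close> and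
  \<open>q\<close> the outer one.\<close>

lemma garnir_trans:
  assumes nodes: "a \<in> nodes T" "p \<in> nodes T" "q \<in> nodes T" and distinct: "a \<noteq> p" "a \<noteq> q" "p \<noteq> q"
    and ap: "\<And>t y. t \<in> tabs \<Longrightarrow> y \<in> set (t p) \<Longrightarrow> F t = (\<Sum>x\<in>set (t a). F (exchange x y t))"
    and pq: "\<And>t y. t \<in> tabs \<Longrightarrow> y \<in> set (t q) \<Longrightarrow> F t = (\<Sum>x\<in>set (t p). F (exchange x y t))"
    and t: "t \<in> tabs" and y: "y \<in> set (t q)"
  shows "F t = (\<Sum>x\<in>set (t a). F (exchange x y t))"
proof -
  note range = entry_in_range[OF t]
  have in_tabs: "exchange x y t \<in> tabs" if "x \<in> set (t b)" "b \<in> nodes T" for x b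
    using t y nodes that by (intro exchange_in_tabs range[of b] range[of q])
  have "(\<Sum>w\<in>set (t a). F (exchange w y t)) =
      (\<Sum>w\<in>set (t a). \<Sum>x\<in>set (t p). F (exchange w y (exchange x y t)))"
  proof (rule sum.cong[OF refl])
    fix w assume w: "w \<in> set (t a)"
    \<comment> \<open>The entry \<open>w\<close> has taken the place of \<open>y\<close> in column
      \<open>q\<close>, so the relation between \<open>p\<close> and \<open>q\<close> may be applied
      to \<open>w\<close>.\<close>
    have "w \<in> set (exchange w y t q)"
      using y by (auto simp: set_permute_entries image_iff intro!: bexI[of _ y])
    moreover have "set (exchange w y t p) = set (t p)"
      using t w y nodes distinct by (intro set_exchange_other[of _ a q]) auto
    ultimately have "F (exchange w y t) = (\<Sum>x\<in>set (t p). F (exchange x w (exchange w y t)))"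
      using pq[OF in_tabs[OF w nodes(1)]] by simp
    also have "\<dots> = (\<Sum>x\<in>set (t p). F (exchange w y (exchange x y t)))"
    proof (rule sum.cong[OF refl])
      fix x assume x: "x \<in> set (t p)"
      have "x \<noteq> w" "x \<noteq> y" "w \<noteq> y" using same_column[OF t] x w y nodes distinct by metis+
      then have "exchange x w (exchange w y t) = exchange w y (exchange x y t)"
        using transpose_triple[of w y x]
        by (simp add: permute_entries_comp transpose_commute)
      then show "F (exchange x w (exchange w y t)) = F (exchange w y (exchange x y t))" by simp
    qed
    finally show "F (exchange w y t) = (\<Sum>x\<in>set (t p). F (exchange w y (exchange x y t)))" .
  qed
  also have "\<dots> = (\<Sum>x\<in>set (t p). \<Sum>w\<in>set (t a). F (exchange w y (exchange x y t)))"
    by (rule sum.swap)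
  also have "\<dots> = (\<Sum>x\<in>set (t p). F (exchange x y t))"
  proof (rule sum.cong[OF refl])
    fix x assume x: "x \<in> set (t p)"
    \<comment> \<open>Now \<open>y\<close> lies in column \<open>p\<close>, which is where the
      relation between \<open>a\<close> and \<open>p\<close> needs it.\<close>
    have "y \<in> set (exchange x y t p)"
      using x by (auto simp: set_permute_entries image_iff intro!: bexI[of _ x])
    moreover have "set (exchange x y t a) = set (t a)"
      using t x y nodes distinct by (intro set_exchange_other[of _ p q]) auto
    ultimately show "(\<Sum>w\<in>set (t a). F (exchange w y (exchange x y t))) = F (exchange x y t)"
      using ap[OF in_tabs[OF x nodes(2)]] by simp
  qed
  also have "\<dots> = F t" using pq[OF t y] by simp
  finally show ?thesis by simp
qed

text \<open>Induction along the path from the root: the relation between a node and its parent is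
  composed with the one between that parent and the root.\<close>

lemma garnir_root:
  assumes "a \<in> nodes T" "a \<noteq> []" "t \<in> tabs" "y \<in> set (t [])"
  shows "F t = (\<Sum>x\<in>set (t a). F (exchange x y t))"
  using assms
proof (induction a arbitrary: t y rule: rev_induct)
  case (snoc i p)
  have p: "p \<in> nodes T" using butlast_in_nodes[OF snoc.prems(1)] by simp
  have parent: "F t = (\<Sum>x\<in>set (t (p @ [i])). F (exchange x y t))"
    if "t \<in> tabs" "y \<in> set (t p)" for t y
    using that snoc.prems(1) by (intro garnir_parent) auto
  show ?case
  proof (cases "p = []")
    case True
    then show ?thesis using parent snoc.prems by simp
  next
    case False
    show ?thesis
      by (rule garnir_trans[where p = p and q = "[]"])
        (use snoc.prems p False parent snoc.IH in auto)
  qed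
qed simp

text \<open>Every colour receives a private non-root column, and the induction measure counts the
  entries of wrong colour in these columns. Measure zero needs no separate case: then all entries
  met in the chosen column have the right colour.\<close>

lemma vanishes_if_few_colours:
  fixes c :: "nat \<Rightarrow> nat"
  assumes m: "m < card (nodes T)" and c: "\<And>x. x \<in> {1..N} \<Longrightarrow> c x < m"
    and colour: "\<And>t x y. t \<in> tabs \<Longrightarrow> x \<in> {1..N} \<Longrightarrow> y \<in> {1..N} \<Longrightarrow> x \<noteq> y \<Longrightarrow> c x = c y \<Longrightarrow>
      F (exchange x y t) = - F t"
    and t: "t \<in> tabs"
  shows "F t = 0"
proof -
  \<comment> \<open>Removing the root leaves at least \<open>m\<close> nodes, enough for an
    injection \<open>h\<close> of the colours.\<close>
  have "card {..<m} \<le> card (nodes T - {[]})" using m finite_nodes by simp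
  then obtain h where h: "inj_on h {..<m}" "h ` {..<m} \<subseteq> nodes T - {[]}"
    using finite_nodes by (meson card_le_inj finite_Diff finite_lessThan)
  define bad where "bad t j = {x \<in> set (t (h j)). c x \<noteq> j}" for t :: "nat list \<Rightarrow> nat list" and j
  show ?thesis using t
  proof (induction "\<Sum>j<m. card (bad t j)" arbitrary: t rule: less_induct)
    case less
    note t = less.prems
    define y where "y = hd (t [])"
    define j where "j = c y"
    define a where "a = h j"
    have y: "y \<in> set (t [])" unfolding y_def using t by (intro hd_in_column) auto
    have yN: "y \<in> {1..N}" using entry_in_range[OF t _ y] by simp
    have j: "j < m" using c[OF yN] by (simp add: j_def)
    then have a: "a \<in> nodes T" "a \<noteq> []" using h(2) by (auto simp: a_def)
    have x_facts: "x \<noteq> y" "x \<in> {1..N}" if "x \<in> set (t a)" for x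
      using same_column[OF t a(1) Nil_in_nodes that] y a(2) entry_in_range[OF t a(1) that] by auto
    have y_notin: "y \<notin> set (t a)" using x_facts(1) by blast
    have hj: "h j = a" by (simp add: a_def)
    have good: "F (exchange x y t) = (if c x = j then - F t else 0)" if x: "x \<in> set (t a)" for x
    proof (cases "c x = j")
      case True
      then show ?thesis using colour[OF t] x_facts[OF x] yN by (simp add: j_def)
    next
      case False
      let ?s = "exchange x y t"
      have s: "?s \<in> tabs" using t x_facts[OF x] yN by (intro exchange_in_tabs)
      \<comment> \<open>The exchange touches only the root and \<open>h j\<close>. The root is not
        in the range of \<open>h\<close>, so the counts of the other colours do not change.\<close>
      have other: "bad ?s k = bad t k" if k: "k \<in> {..<m} - {j}" for k
      proof -
        have "h k \<noteq> a" "h k \<noteq> []" "h k \<in> nodes T"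
          using h k j by (auto simp: a_def inj_on_def)
        then show ?thesis
          unfolding bad_def using set_exchange_other[OF t a(1) Nil_in_nodes _ x y] by simp
      qed
      \<comment> \<open>In column \<open>h j\<close> the wrongly coloured \<open>x\<close> is
        replaced by \<open>y\<close>, whose colour is \<open>j\<close>.\<close>
      have "bad ?s j \<subseteq> bad t j - {x}"
        using x_facts False x y_notin hj
        by (auto simp: bad_def set_permute_entries Transposition.transpose_def j_def split: if_splits)
      moreover have "x \<in> bad t j" using x False by (simp add: bad_def a_def)
      moreover have fin: "finite (bad t j)" by (simp add: bad_def)
      ultimately have "card (bad ?s j) < card (bad t j)"
        by (intro psubset_card_mono) auto
      then have "(\<Sum>k<m. card (bad ?s k)) < (\<Sum>k<m. card (bad t k))"
        using j other by (simp add: sum.remove[of "{..<m}" j])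
      then show ?thesis using less.hyps[OF _ s] False by simp
    qed
    have "F t = (\<Sum>x\<in>set (t a). F (exchange x y t))" using a t y by (intro garnir_root)
    also have "\<dots> = (\<Sum>x\<in>set (t a). if c x = j then - F t else 0)"
      using good by (rule sum.cong[OF refl])
    also have "\<dots> = - (of_nat (card {x \<in> set (t a). c x = j}) * F t)"
      by (simp add: sum.inter_filter[symmetric])
    \<comment> \<open>The coefficient is one more than a cardinality, hence nonzero in the complex
      numbers.\<close>
    finally have "of_nat (Suc (card {x \<in> set (t a). c x = j})) * F t = 0"
      by (simp add: distrib_right flip: eq_neg_iff_add_eq_0)
    then show ?case by (simp del: of_nat_Suc)
  qed
qed

text \<open>The relations are equivariant, so the signed sum \<open>F'\<close> of translates of
  \<open>F\<close> satisfies them again. Reindexing the sum by a transposition inside one colour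
  class shows that \<open>F'\<close> also changes sign there, and
  \<open>vanishes_if_few_colours\<close> applies to \<open>F'\<close>.\<close>

lemma alternating_sum_vanishes:
  fixes c :: "nat \<Rightarrow> nat"
  assumes m: "m < card (nodes T)" and c: "\<And>x. x \<in> {1..N} \<Longrightarrow> c x < m" and t: "t \<in> tabs"
  shows "(\<Sum>\<sigma> | \<sigma> permutes {1..N} \<and> (\<forall>x\<in>{1..N}. c (\<sigma> x) = c x).
      of_int (sign \<sigma>) * F (permute_entries \<sigma> t)) = 0"
proof -
  define H where "H = {\<sigma>. \<sigma> permutes {1..N} \<and> (\<forall>x\<in>{1..N}. c (\<sigma> x) = c x)}"
  define F' where "F' t = (\<Sum>\<sigma>\<in>H. of_int (sign \<sigma>) * F (permute_entries \<sigma> t))" for t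
  have H: "\<sigma> permutes {1..N}" "inj \<sigma>" if "\<sigma> \<in> H" for \<sigma>
    using that permutes_inj by (auto simp: H_def)
  interpret F': garnir_function T \<mu> N F'
  proof unfold_locales
    fix t a x y assume *: "t \<in> tabs" "a \<in> nodes T" "x \<in> set (t a)" "y \<in> set (t a)" "x \<noteq> y"
    have "F (permute_entries \<sigma> (exchange x y t)) = - F (permute_entries \<sigma> t)" if "\<sigma> \<in> H" for \<sigma>
      unfolding permute_exchange[OF H(2)[OF that]]
      using * H[OF that] by (intro antisym[of _ a] permute_in_tabs) (auto simp: set_permute_entries inj_eq)
    then show "F' (exchange x y t) = - F' t"
      by (simp add: F'_def sum_negf)
  next
    fix t a assume *: "t \<in> tabs" "a \<in> nodes T" "a \<noteq> []"
    have "F (permute_entries \<sigma> t) =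
        (\<Sum>x\<in>set (t a). F (permute_entries \<sigma> (exchange x (hd (t (butlast a))) t)))" if \<sigma>: "\<sigma> \<in> H" for \<sigma>
    proof -
      have "t (butlast a) \<noteq> []"
        using hd_in_column[OF *(1) butlast_in_nodes[OF *(2)]] by auto
      then have "hd (permute_entries \<sigma> t (butlast a)) = \<sigma> (hd (t (butlast a)))"
        by (simp add: permute_entries_def hd_map)
      then have "F (permute_entries \<sigma> t) =
          (\<Sum>x\<in>\<sigma> ` set (t a). F (exchange x (\<sigma> (hd (t (butlast a)))) (permute_entries \<sigma> t)))"
        using garnir_top[OF permute_in_tabs[OF H(1)[OF \<sigma>] *(1)] *(2,3)] by (simp add: set_permute_entries)
      also have "\<dots> = (\<Sum>x\<in>set (t a). F (exchange (\<sigma> x) (\<sigma> (hd (t (butlast a)))) (permute_entries \<sigma> t)))"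
        using H(2)[OF \<sigma>] by (subst sum.reindex) (auto intro: inj_on_subset[OF _ subset_UNIV])
      finally show ?thesis by (simp add: permute_exchange[OF H(2)[OF \<sigma>]])
    qed
    then have "F' t = (\<Sum>\<sigma>\<in>H. \<Sum>x\<in>set (t a).
        of_int (sign \<sigma>) * F (permute_entries \<sigma> (exchange x (hd (t (butlast a))) t)))"
      by (simp add: F'_def sum_distrib_left)
    then show "F' t = (\<Sum>x\<in>set (t a). F' (exchange x (hd (t (butlast a))) t))"
      unfolding F'_def by (subst (asm) sum.swap)
  qed
  have "F' t = 0"
  proof (rule F'.vanishes_if_few_colours[OF m c _ t])
    fix t x y assume *: "t \<in> tabs" "x \<in> {1..N}" "y \<in> {1..N}" "x \<noteq> y" "c x = c y"
    let ?\<tau> = "Transposition.transpose x y"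
    have \<tau>: "?\<tau> permutes {1..N}" using * by (intro transpose_permutes)
    \<comment> \<open>Equality of the colours of \<open>x\<close> and \<open>y\<close> keeps the
      product in \<open>H\<close>.\<close>
    have cl: "\<sigma> \<circ> ?\<tau> \<in> H" if "\<sigma> \<in> H" for \<sigma>
      using that * permutes_compose[OF \<tau>, of \<sigma>] permutes_in_image[OF \<tau>]
      by (auto simp: H_def Transposition.transpose_def)
    have bij: "bij_betw (\<lambda>\<sigma>. \<sigma> \<circ> ?\<tau>) H H"
      using cl by (intro bij_betw_byWitness[of _ "\<lambda>\<sigma>. \<sigma> \<circ> ?\<tau>"]) (auto simp: comp_assoc)
    have sgn: "sign (\<sigma> \<circ> ?\<tau>) = - sign \<sigma>" if "\<sigma> \<in> H" for \<sigma>
      using that * \<tau> H(1)[OF that] permutation_permutes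
      by (subst sign_compose) (auto simp: sign_swap_id intro: permutation_swap_id)
    have "F' t = (\<Sum>\<sigma>\<in>H. of_int (sign (\<sigma> \<circ> ?\<tau>)) * F (permute_entries (\<sigma> \<circ> ?\<tau>) t))"
      unfolding F'_def by (rule sum.reindex_bij_betw[OF bij, symmetric])
    also have "\<dots> = - F' (exchange x y t)"
      by (simp add: F'_def sgn permute_entries_comp sum_negf)
    finally show "F' (exchange x y t) = - F' t" by simp
  qed
  then show ?thesis by (simp add: F'_def H_def)
qed

text \<open>By the pigeonhole principle two entries of \<open>S\<close> share a column of
  \<open>t\<close>. Right multiplication by their transposition permutes \<open>H\<close> and
  negates every summand, so the sum equals its own negative.\<close>

lemma symmetric_sum_vanishes:
  assumes S: "S \<subseteq> {1..N}" "card (nodes T) < card S" and t: "t \<in> tabs"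
    and H: "\<And>\<sigma>. \<sigma> \<in> H \<Longrightarrow> \<sigma> permutes {1..N}"
    and cl: "\<And>\<sigma> x y. \<sigma> \<in> H \<Longrightarrow> x \<in> S \<Longrightarrow> y \<in> S \<Longrightarrow> \<sigma> \<circ> Transposition.transpose x y \<in> H"
  shows "(\<Sum>\<sigma>\<in>H. F (permute_entries \<sigma> t)) = 0"
proof -
  have "\<forall>x\<in>S. \<exists>a\<in>nodes T. x \<in> set (t a)"
    using t S(1) unfolding tree_tableaux_def by blast
  then obtain col where col: "\<And>x. x \<in> S \<Longrightarrow> col x \<in> nodes T \<and> x \<in> set (t (col x))" by metis
  have "card (col ` S) < card S"
    using S(2) col card_mono[OF finite_nodes, of "col ` S" T] by (meson image_subsetI le_less_trans)
  then have "\<not> inj_on col S" using card_image by fastforce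
  then obtain x y where xy: "x \<in> S" "y \<in> S" "x \<noteq> y" "col x = col y" by (auto simp: inj_on_def)
  let ?\<tau> = "Transposition.transpose x y"
  have bij: "bij_betw (\<lambda>\<sigma>. \<sigma> \<circ> ?\<tau>) H H"
    using cl xy by (intro bij_betw_byWitness[of _ "\<lambda>\<sigma>. \<sigma> \<circ> ?\<tau>"]) (auto simp: comp_assoc)
  have "F (permute_entries (\<sigma> \<circ> ?\<tau>) t) = - F (permute_entries \<sigma> t)" if "\<sigma> \<in> H" for \<sigma>
    unfolding permute_entries_comp[symmetric] permute_exchange[OF permutes_inj[OF H[OF that]]]
    using xy col[OF xy(1)] col[OF xy(2)] t H[OF that] permutes_inj[OF H[OF that]]
    by (intro antisym[of _ "col x"] permute_in_tabs) (auto simp: set_permute_entries inj_eq)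
  then have "(\<Sum>\<sigma>\<in>H. F (permute_entries \<sigma> t)) = - (\<Sum>\<sigma>\<in>H. F (permute_entries \<sigma> t))"
    using sum.reindex_bij_betw[OF bij, of "\<lambda>\<sigma>. F (permute_entries \<sigma> t)"] by (simp add: sum_negf)
  then show ?thesis by simp
qed

end

section \<open>The tree Specht module as a quotient of a permutation representation\<close>

lemma mod_hom_finsum:
  assumes "mod_hom R M N h" "g \<in> S \<rightarrow> carrier M"
  shows "h (finsum M g S) = finsum N (\<lambda>s. h (g s)) S"
proof -
  interpret mod_hom R M N h by fact
  have im: "h v \<in> carrier N" if "v \<in> carrier M" for v
    using that by (rule f_im)
  show ?thesis using assms(2)
  proof (induction S rule: infinite_finite_induct)
    case (insert x S)
    then have "finsum N (\<lambda>s. h (g s)) (insert x S) = h (g x) \<oplus>\<^bsub>N\<^esub> finsum N (\<lambda>s. h (g s)) S"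
      by (intro N.M.finsum_insert) (auto intro!: im)
    with insert show ?case by auto
  qed auto
qed

context tree_shape
begin

sublocale tab: perm_action N tabs permute_entries
proof
  show "permute_entries (inv_into UNIV \<sigma>) (permute_entries \<sigma> t) = t" if "\<sigma> permutes {1..N}" for \<sigma> t
    using permutes_inv_o(2)[OF that] by (simp add: permute_entries_comp) (simp add: permute_entries_def)
qed (rule permute_in_tabs)

abbreviation "free \<equiv> free_tableau_rep T \<mu> N"

lemma rep_space_free: "rep_space free = ring.func_space CC tabs"
  by (simp add: free_tableau_rep_def perm_rep_def)

lemma linear_rep_free: "linear_rep N free"
  unfolding free_tableau_rep_def by (rule tab.linear_rep_axioms)

lemma act_basis: 
  "\<sigma> permutes {1..N} \<Longrightarrow> t \<in> tabs \<Longrightarrow>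
    rep_act free \<sigma> (basis_vec tabs t) = basis_vec tabs (permute_entries \<sigma> t)"
  unfolding free_tableau_rep_def by (rule tab.act_basis_vec)

lemma basis_closed: "basis_vec tabs t \<in> carrier (rep_space free)"
  by (simp add: rep_space_free)

sublocale free: linear_rep N free by (rule linear_rep_free)

lemma column_relations_closed: "column_relations T \<mu> N \<subseteq> carrier (rep_space free)"
  unfolding column_relations_def by (auto intro!: free.V.M.a_closed basis_closed)

text \<open>A permutation \<sigma> sends the column relation of \<open>t\<close>, \<open>x\<close>,
  \<open>y\<close> to that of the permuted tableau and the entries \<open>\<sigma> x\<close>,
  \<open>\<sigma> y\<close>; the set of relations is thus preserved.\<close>

sublocale col: invariant_subspace N free "column_relation_space T \<mu> N"
proof (intro invariant_subspace.intro invariant_subspace_axioms.intro linear_rep_free)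
  show "submodule CC (column_relation_space T \<mu> N) (rep_space free)"
    unfolding column_relation_space_def by (intro free.V.span_is_submodule column_relations_closed)
next
  fix \<sigma> w assume \<sigma>: "\<sigma> permutes {1..N}" and w: "w \<in> column_relation_space T \<mu> N"
  have "rep_act free \<sigma> v \<in> column_relations T \<mu> N" if "v \<in> column_relations T \<mu> N" for v
  proof -
    from that obtain t a x y where *: "t \<in> tabs" "a \<in> nodes T" "x \<in> set (t a)" "y \<in> set (t a)" "x \<noteq> y"
      and v: "v = basis_vec tabs t \<oplus>\<^bsub>rep_space free\<^esub> basis_vec tabs (exchange x y t)"
      by (auto simp: column_relations_def)
    have "exchange x y t \<in> tabs" using * entry_in_range by (intro exchange_in_tabs) blast+
    then have "rep_act free \<sigma> v = basis_vec tabs (permute_entries \<sigma> t) \<oplus>\<^bsub>rep_space free\<^esub>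
        basis_vec tabs (exchange (\<sigma> x) (\<sigma> y) (permute_entries \<sigma> t))"
      unfolding v using \<sigma> *(1)
      by (simp add: free.act_add basis_closed act_basis permute_exchange permutes_inj del: One_nat_def)
    moreover have "permute_entries \<sigma> t \<in> tabs" "\<sigma> x \<in> set (permute_entries \<sigma> t a)"
        "\<sigma> y \<in> set (permute_entries \<sigma> t a)" "\<sigma> x \<noteq> \<sigma> y"
      using permute_in_tabs[OF \<sigma>] * permutes_inj[OF \<sigma>] by (auto simp: set_permute_entries inj_eq)
    ultimately show ?thesis
      using *(2) unfolding column_relations_def by blast
  qed
  then show "rep_act free \<sigma> w \<in> column_relation_space T \<mu> N"
    using w unfolding column_relation_space_def
    by (intro free.span_invariant column_relations_closed \<sigma>)
qed

section \<open>The module \<open>M\<close> and its Garnir relations\<close>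

abbreviation "M \<equiv> M_rep T \<mu> N"

sublocale M: linear_rep N M
  unfolding M_rep_def by (rule col.linear_rep_quotient)

sublocale col_proj: mod_hom CC "rep_space free" "rep_space M" col.proj
  unfolding M_rep_def by (rule col.proj_mod_hom)

text \<open>The index set of the sum in \<open>garnir\<close>, written as an image so that sums over
  it can be reindexed.\<close>

definition swapped :: "nat list \<Rightarrow> (nat list \<Rightarrow> nat list) \<Rightarrow> (nat list \<Rightarrow> nat list) set" where
  "swapped a t = (\<lambda>x. exchange x (hd (t (butlast a))) t) ` set (t a)"

text \<open>A representative of the Garnir relation before the column relations are divided out, so
  that computations take place with functions instead of cosets.\<close>

definition garnir_lift :: "nat list \<Rightarrow> (nat list \<Rightarrow> nat list) \<Rightarrow> (nat list \<Rightarrow> nat list) \<Rightarrow> complex" where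
  "garnir_lift a t = basis_vec tabs t \<ominus>\<^bsub>rep_space free\<^esub>
     (\<Oplus>\<^bsub>rep_space free\<^esub> s \<in> swapped a t. basis_vec tabs s)"

lemma garnir_lift_closed: "garnir_lift a t \<in> carrier (rep_space free)"
  unfolding garnir_lift_def
  by (intro free.V.M.minus_closed free.V.M.finsum_closed Pi_I basis_closed)

lemma proj_garnir_lift: "col.proj (garnir_lift a t) = garnir T \<mu> N a t"
proof -
  have "col.proj (garnir_lift a t) = col.proj (basis_vec tabs t) \<ominus>\<^bsub>rep_space M\<^esub>
      (\<Oplus>\<^bsub>rep_space M\<^esub> s \<in> swapped a t. col.proj (basis_vec tabs s))"
    unfolding garnir_lift_def
    using mod_hom_finsum[OF col_proj.mod_hom_axioms, of "basis_vec tabs" "swapped a t"]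
    by (simp add: basis_closed)
  then show ?thesis by (simp add: garnir_def tableau_class_def swapped_def Setcompr_eq_image)
qed

lemma swapped_in_tabs:
  assumes "a \<in> nodes T" "t \<in> tabs" "s \<in> swapped a t"
  shows "s \<in> tabs"
proof -
  note p = butlast_in_nodes[OF assms(1)]
  obtain x where x: "x \<in> set (t a)" "s = exchange x (hd (t (butlast a))) t"
    using assms(3) by (auto simp: swapped_def)
  show ?thesis
    unfolding x(2) using assms(2) entry_in_range[OF assms(2,1) x(1)]
      entry_in_range[OF assms(2) p hd_in_column[OF assms(2) p]]
    by (rule exchange_in_tabs)
qed

lemma act_garnir_lift:
  assumes \<sigma>: "\<sigma> permutes {1..N}" and a: "a \<in> nodes T" and t: "t \<in> tabs"
  shows "rep_act free \<sigma> (garnir_lift a t) = garnir_lift a (permute_entries \<sigma> t)"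
proof -
  interpret h: mod_hom CC "rep_space free" "rep_space free" "rep_act free \<sigma>"
    using \<sigma> by (rule free.act_mod_hom)
  \<comment> \<open>\<open>hd\<close> commutes with \<open>map\<close> on nonempty lists; the parent
    column is nonempty because \<mu> is positive.\<close>
  have "t (butlast a) \<noteq> []"
    using hd_in_column[OF t butlast_in_nodes[OF a]] by auto
  then have hd: "hd (permute_entries \<sigma> t (butlast a)) = \<sigma> (hd (t (butlast a)))"
    by (simp add: permute_entries_def hd_map)
  have swapped: "swapped a (permute_entries \<sigma> t) = permute_entries \<sigma> ` swapped a t"
    unfolding swapped_def hd set_permute_entries image_image permute_exchange[OF permutes_inj[OF \<sigma>]] ..
  \<comment> \<open>Distinct tableaux stay distinct, so the sum may be reindexed along the
    action.\<close>
  have inj: "inj_on (permute_entries \<sigma>) (swapped a t)"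
    by (rule inj_on_subset[OF bij_betw_imp_inj_on[OF tab.bij_betw_action[OF \<sigma>]]])
      (rule subsetI, rule swapped_in_tabs[OF a t])
  have "rep_act free \<sigma> (garnir_lift a t) = rep_act free \<sigma> (basis_vec tabs t) \<ominus>\<^bsub>rep_space free\<^esub>
      (\<Oplus>\<^bsub>rep_space free\<^esub> s \<in> swapped a t. rep_act free \<sigma> (basis_vec tabs s))"
    unfolding garnir_lift_def
    using mod_hom_finsum[OF h.mod_hom_axioms, of "basis_vec tabs" "swapped a t"]
    by (simp add: basis_closed)
  also have "(\<Oplus>\<^bsub>rep_space free\<^esub> s \<in> swapped a t. rep_act free \<sigma> (basis_vec tabs s)) =
      (\<Oplus>\<^bsub>rep_space free\<^esub> s \<in> swapped a t. basis_vec tabs (permute_entries \<sigma> s))"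
    using swapped_in_tabs[OF a t]
    by (intro free.V.M.finsum_cong') (auto simp: act_basis[OF \<sigma>] basis_closed)
  also have "\<dots> = (\<Oplus>\<^bsub>rep_space free\<^esub> s \<in> swapped a (permute_entries \<sigma> t). basis_vec tabs s)"
    unfolding swapped using inj by (intro free.V.M.finsum_reindex[symmetric]) (auto simp: basis_closed)
  finally show ?thesis by (simp add: garnir_lift_def act_basis[OF \<sigma> t])
qed

abbreviation "garnirs \<equiv> {garnir T \<mu> N a t | a t. a \<in> nodes T \<and> a \<noteq> [] \<and> t \<in> tabs}"

lemma garnirs_closed: "garnirs \<subseteq> carrier (rep_space M)"
  using col_proj.f_im[OF garnir_lift_closed] unfolding proj_garnir_lift by blast

sublocale gar: invariant_subspace N M "garnir_space T \<mu> N"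
proof (intro invariant_subspace.intro invariant_subspace_axioms.intro M.linear_rep_axioms)
  show "submodule CC (garnir_space T \<mu> N) (rep_space M)"
    unfolding garnir_space_def by (intro M.V.span_is_submodule garnirs_closed)
next
  fix \<sigma> w assume \<sigma>: "\<sigma> permutes {1..N}" and w: "w \<in> garnir_space T \<mu> N"
  have "rep_act M \<sigma> v \<in> garnirs" if "v \<in> garnirs" for v
  proof -
    from that obtain a t where *: "a \<in> nodes T" "a \<noteq> []" "t \<in> tabs" "v = garnir T \<mu> N a t" by auto
    then have "rep_act M \<sigma> v = garnir T \<mu> N a (permute_entries \<sigma> t)"
      using col.act_quotient[OF \<sigma> garnir_lift_closed] act_garnir_lift[OF \<sigma> *(1,3)]
      by (simp add: proj_garnir_lift M_rep_def)
    then show ?thesis using * permute_in_tabs[OF \<sigma>] by blast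
  qed
  then show "rep_act M \<sigma> w \<in> garnir_space T \<mu> N"
    using w unfolding garnir_space_def
    by (intro M.span_invariant garnirs_closed \<sigma>)
qed

section \<open>The tree Specht module and its functionals\<close>

abbreviation "Q \<equiv> tree_specht T \<mu> N"

sublocale Q: linear_rep N Q
  unfolding tree_specht_def by (rule gar.linear_rep_quotient)

sublocale gar_proj: mod_hom CC "rep_space M" "rep_space Q" gar.proj
  unfolding tree_specht_def by (rule gar.proj_mod_hom)

text \<open>Composing both projections presents the tree Specht module as a single quotient of the
  free space on tableaux.\<close>

definition \<pi> where "\<pi> v = gar.proj (col.proj v)"

sublocale \<pi>: mod_hom CC "rep_space free" "rep_space Q" \<pi>
proof (unfold mod_hom_def mod_hom_axioms_def, intro conjI)
  show "\<pi> \<in> LinearCombinations.module_hom CC (rep_space free) (rep_space Q)"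
    unfolding LinearCombinations.module_hom_def \<pi>_def by auto
qed (rule free.is_module Q.is_module)+

lemma carrier_Q: "carrier (rep_space Q) = \<pi> ` carrier (rep_space free)"
  unfolding \<pi>_def using col.carrier_quotient gar.carrier_quotient
  by (simp add: tree_specht_def M_rep_def image_image)

lemma act_\<pi>:
  "\<sigma> permutes {1..N} \<Longrightarrow> v \<in> carrier (rep_space free) \<Longrightarrow>
    rep_act Q \<sigma> (\<pi> v) = \<pi> (rep_act free \<sigma> v)"
  using col.act_quotient[of \<sigma> v, folded M_rep_def] gar.act_quotient[of \<sigma> "col.proj v", folded tree_specht_def]
    col_proj.f_im[of v]
  by (simp only: \<pi>_def)

lemma \<pi>_column_relation:
  assumes "w \<in> column_relations T \<mu> N"
  shows "\<pi> w = \<zero>\<^bsub>rep_space Q\<^esub>"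
proof -
  have "w \<in> column_relation_space T \<mu> N"
    using assms free.V.in_own_span[OF column_relations_closed] by (auto simp: column_relation_space_def)
  then show ?thesis using col.proj_eq_zero[of w] by (simp add: \<pi>_def M_rep_def[symmetric])
qed

lemma \<pi>_garnir_lift:
  assumes "a \<in> nodes T" "a \<noteq> []" "t \<in> tabs"
  shows "\<pi> (garnir_lift a t) = \<zero>\<^bsub>rep_space Q\<^esub>"
proof -
  have "garnir T \<mu> N a t \<in> garnir_space T \<mu> N"
    using assms M.V.in_own_span[OF garnirs_closed] by (auto simp: garnir_space_def)
  then show ?thesis using gar.proj_eq_zero by (simp add: \<pi>_def proj_garnir_lift tree_specht_def)
qed

text \<open>The pairing with \<phi> kills the kernel of \<pi>. Evaluating it at the column relations
  and at the lifted Garnir relations gives the two families of equations.\<close>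

lemma garnir_function_of_functional:
  assumes \<phi>: "\<And>w. w \<in> carrier (rep_space free) \<Longrightarrow> \<pi> w = \<zero>\<^bsub>rep_space Q\<^esub> \<Longrightarrow>
    (\<Sum>x\<in>tabs. \<phi> x * w x) = 0"
  shows "garnir_function T \<mu> N \<phi>"
proof
  fix t a x y assume *: "t \<in> tabs" "a \<in> nodes T" "x \<in> set (t a)" "y \<in> set (t a)" "x \<noteq> y"
  let ?w = "basis_vec tabs t \<oplus>\<^bsub>rep_space free\<^esub> basis_vec tabs (exchange x y t)"
  have "exchange x y t \<in> tabs" using * entry_in_range by (intro exchange_in_tabs) blast+
  moreover have w: "?w \<in> column_relations T \<mu> N" using * unfolding column_relations_def by blast
  ultimately have "(\<Sum>x\<in>tabs. \<phi> x * ?w x) = \<phi> t + \<phi> (exchange x y t)"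
    using * by (simp add: rep_space_free distrib_left sum.distrib sum_mult_basis_vec finite_tabs)
  moreover have "(\<Sum>x\<in>tabs. \<phi> x * ?w x) = 0"
    using w column_relations_closed \<pi>_column_relation by (intro \<phi>) auto
  ultimately show "\<phi> (exchange x y t) = - \<phi> t"
    by (simp add: eq_neg_iff_add_eq_0 add.commute)
next
  fix t a assume *: "t \<in> tabs" "a \<in> nodes T" "a \<noteq> []"
  define y where "y = hd (t (butlast a))"
  have y: "y \<in> set (t (butlast a))" unfolding y_def using * by (intro hd_in_column butlast_in_nodes)
  \<comment> \<open>A Garnir relation sums over a set of tableaux, a Garnir function over entries of
    a column; injectivity makes the two sums agree.\<close>
  have inj: "inj_on (\<lambda>x. exchange x y t) (set (t a))"
  proof (rule inj_onI)
    fix x x' assume x: "x \<in> set (t a)" "x' \<in> set (t a)" and eq: "exchange x y t = exchange x' y t"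
    have "butlast a \<noteq> a"
      using * by (metis append_butlast_last_id append_self_conv not_Cons_self2)
    then have "y \<notin> set (t a)"
      using same_column[OF *(1) _ *(2) y] butlast_in_nodes[OF *(2)] by blast
    \<comment> \<open>The two columns at \<open>a\<close> are compared at the position of
      \<open>x\<close>, where the first one has \<open>y\<close>.\<close>
    then have "Transposition.transpose x' y x = y"
      using eq x by (auto simp: permute_entries_def fun_eq_iff dest!: spec[of _ a])
    then show "x = x'" using \<open>y \<notin> set (t a)\<close> x
      by (auto simp: Transposition.transpose_def split: if_splits)
  qed
  have swapped: "swapped a t = (\<lambda>x. exchange x y t) ` set (t a)"
    by (auto simp: swapped_def y_def)
  have lift: "garnir_lift a t z = basis_vec tabs t z - (\<Sum>s\<in>swapped a t. basis_vec tabs s z)"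
    if "z \<in> tabs" for z
  proof -
    have "finsum (rep_space free) (basis_vec tabs) (swapped a t) \<in> carrier (rep_space free)"
      by (intro free.V.M.finsum_closed Pi_I basis_closed)
    then show ?thesis
      unfolding garnir_lift_def rep_space_free using that
      by (subst func_space_minus) (auto simp: func_space_finsum)
  qed
  have "0 = (\<Sum>z\<in>tabs. \<phi> z * garnir_lift a t z)"
    using * by (intro \<phi>[symmetric] garnir_lift_closed \<pi>_garnir_lift)
  also have "\<dots> = (\<Sum>z\<in>tabs. \<phi> z * basis_vec tabs t z) -
      (\<Sum>s\<in>swapped a t. \<Sum>z\<in>tabs. \<phi> z * basis_vec tabs s z)"
    by (subst sum.swap) (simp add: lift right_diff_distrib sum_subtractf sum_distrib_left)
  also have "\<dots> = \<phi> t - (\<Sum>s\<in>swapped a t. \<phi> s)"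
    using * swapped_in_tabs by (simp add: sum_mult_basis_vec finite_tabs)
  also have "(\<Sum>s\<in>swapped a t. \<phi> s) = (\<Sum>x\<in>set (t a). \<phi> (exchange x y t))"
    unfolding swapped using inj by (simp add: sum.reindex)
  finally show "\<phi> t = (\<Sum>x\<in>set (t a). \<phi> (exchange x (hd (t (butlast a))) t))"
    by (simp add: y_def)
qed

text \<open>The embedding carries the nonzero group algebra image of \<open>e\<close> to a nonzero
  vector of the tree Specht module. A functional on the free space that kills the kernel of \<pi>
  but not a lift of this vector gives \<open>F\<close>.\<close>

lemma detecting_garnir_function:
  assumes U: "linear_rep N U" and contained: "contained_in N U Q"
    and e: "e \<in> carrier (rep_space U)" and H: "\<And>\<sigma>. \<sigma> \<in> H \<Longrightarrow> \<sigma> permutes {1..N}"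
    and nz: "(\<Oplus>\<^bsub>rep_space U\<^esub> \<sigma> \<in> H. \<chi> \<sigma> \<odot>\<^bsub>rep_space U\<^esub> rep_act U \<sigma> e) \<noteq> \<zero>\<^bsub>rep_space U\<^esub>"
  obtains F t where "garnir_function T \<mu> N F" "t \<in> tabs" "(\<Sum>\<sigma>\<in>H. \<chi> \<sigma> * F (permute_entries \<sigma> t)) \<noteq> 0"
proof -
  interpret U: linear_rep N U by (rule U)
  from contained obtain W f where W: "subrep N Q W"
    and f: "f \<in> LinearCombinations.module_hom CC (rep_space U) (rep_space (restrict_rep Q W))"
    and bij: "bij_betw f (carrier (rep_space U)) (carrier (rep_space (restrict_rep Q W)))"
    and equiv: "\<And>\<sigma> u. \<sigma> permutes {1..N} \<Longrightarrow> u \<in> carrier (rep_space U) \<Longrightarrow>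
      f (rep_act U \<sigma> u) = rep_act (restrict_rep Q W) \<sigma> (f u)"
    unfolding contained_in_def isomorphic_rep_def by blast
  have WQ: "W \<subseteq> carrier (rep_space Q)"
    using W by (auto simp: subrep_def VectorSpace.subspace_def submodule_def)
  have "f \<in> LinearCombinations.module_hom CC (rep_space U) (rep_space Q)"
    using f WQ by (auto simp: LinearCombinations.module_hom_def restrict_rep_def)
  then interpret f: mod_hom CC "rep_space U" "rep_space Q" f
    by (simp add: mod_hom_def mod_hom_axioms_def U.is_module Q.is_module)
  have "f e \<in> carrier (rep_space Q)" using e by (rule f.f_im)
  then obtain v where v: "v \<in> carrier (rep_space free)" "f e = \<pi> v" by (auto simp: carrier_Q)
  define ev where "ev = (\<Oplus>\<^bsub>rep_space free\<^esub> \<sigma> \<in> H. \<chi> \<sigma> \<odot>\<^bsub>rep_space free\<^esub> rep_act free \<sigma> v)"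
  let ?eu = "\<Oplus>\<^bsub>rep_space U\<^esub> \<sigma> \<in> H. \<chi> \<sigma> \<odot>\<^bsub>rep_space U\<^esub> rep_act U \<sigma> e"
  have eu_cl: "(\<lambda>\<sigma>. \<chi> \<sigma> \<odot>\<^bsub>rep_space U\<^esub> rep_act U \<sigma> e) \<in> H \<rightarrow> carrier (rep_space U)"
    using U.act_closed[OF H e] by auto
  have ev_cl: "(\<lambda>\<sigma>. \<chi> \<sigma> \<odot>\<^bsub>rep_space free\<^esub> rep_act free \<sigma> v) \<in> H \<rightarrow> carrier (rep_space free)"
    using free.act_closed[OF H v(1)] by (auto intro!: free.V.smult_closed)
  have "f ?eu = (\<Oplus>\<^bsub>rep_space Q\<^esub> \<sigma> \<in> H. f (\<chi> \<sigma> \<odot>\<^bsub>rep_space U\<^esub> rep_act U \<sigma> e))"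
    by (rule mod_hom_finsum[OF f.mod_hom_axioms eu_cl])
  also have "\<dots> = (\<Oplus>\<^bsub>rep_space Q\<^esub> \<sigma> \<in> H. \<pi> (\<chi> \<sigma> \<odot>\<^bsub>rep_space free\<^esub> rep_act free \<sigma> v))"
  proof (rule Q.V.M.finsum_cong'[OF refl])
    show "(\<lambda>\<sigma>. \<pi> (\<chi> \<sigma> \<odot>\<^bsub>rep_space free\<^esub> rep_act free \<sigma> v)) \<in> H \<rightarrow> carrier (rep_space Q)"
      using ev_cl by (auto intro!: \<pi>.f_im)
    show "f (\<chi> \<sigma> \<odot>\<^bsub>rep_space U\<^esub> rep_act U \<sigma> e) =
        \<pi> (\<chi> \<sigma> \<odot>\<^bsub>rep_space free\<^esub> rep_act free \<sigma> v)" if "\<sigma> \<in> H" for \<sigma>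
    proof -
      have "f (rep_act U \<sigma> e) = \<pi> (rep_act free \<sigma> v)"
        using equiv[OF H e, OF that] act_\<pi>[OF H v(1), OF that] v(2) by (simp add: restrict_rep_def)
      then show ?thesis
        using f.f_smult[of "\<chi> \<sigma>" "rep_act U \<sigma> e"] \<pi>.f_smult[of "\<chi> \<sigma>" "rep_act free \<sigma> v"]
          U.act_closed[OF H e, OF that] free.act_closed[OF H v(1), OF that] by simp
    qed
  qed
  also have "\<dots> = \<pi> ev"
    unfolding ev_def by (rule mod_hom_finsum[OF \<pi>.mod_hom_axioms ev_cl, symmetric])
  finally have "f ?eu = \<pi> ev" .
  \<comment> \<open>The isomorphism onto the subrepresentation is injective, so nonvanishing is
    preserved.\<close>
  moreover have "f ?eu \<noteq> f \<zero>\<^bsub>rep_space U\<^esub>"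
    using bij nz U.V.M.finsum_closed[OF eu_cl] by (auto simp: bij_betw_def inj_on_def)
  ultimately have ev: "\<pi> ev \<noteq> \<zero>\<^bsub>rep_space Q\<^esub>" by simp
  obtain \<phi> where \<phi>: "\<And>w. w \<in> \<pi>.ker \<Longrightarrow> (\<Sum>x\<in>tabs. \<phi> x * w x) = 0" "(\<Sum>x\<in>tabs. \<phi> x * ev x) \<noteq> 0"
  proof (rule separating_functional[OF finite_tabs])
    show "submodule CC \<pi>.ker (ring.func_space CC tabs)"
      using \<pi>.ker_is_submodule by (simp add: rep_space_free)
    show "ev \<in> tabs \<rightarrow>\<^sub>E UNIV"
      unfolding ev_def using free.V.M.finsum_closed[OF ev_cl] by (simp add: rep_space_free)
    show "ev \<notin> \<pi>.ker" using ev by (simp add: \<pi>.ker_def)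
  qed blast
  have "(\<Sum>x\<in>tabs. \<phi> x * ev x) = (\<Sum>\<sigma>\<in>H. \<chi> \<sigma> * (\<Sum>x\<in>tabs. \<phi> x * rep_act free \<sigma> v x))"
  proof -
    have "ev x = (\<Sum>\<sigma>\<in>H. \<chi> \<sigma> * rep_act free \<sigma> v x)" if "x \<in> tabs" for x
      using ev_cl that unfolding ev_def rep_space_free by (subst func_space_finsum) auto
    then show ?thesis
      by (simp add: sum_distrib_left mult.left_commute) (subst sum.swap, simp)
  qed
  \<comment> \<open>The action is moved from the lift \<open>v\<close> onto \<phi>.\<close>
  also have "\<dots> = (\<Sum>\<sigma>\<in>H. \<chi> \<sigma> * (\<Sum>x\<in>tabs. \<phi> (permute_entries \<sigma> x) * v x))"
    using tab.sum_mult_act[OF H] by (simp add: free_tableau_rep_def)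
  also have "\<dots> = (\<Sum>x\<in>tabs. (\<Sum>\<sigma>\<in>H. \<chi> \<sigma> * \<phi> (permute_entries \<sigma> x)) * v x)"
    by (simp add: sum_distrib_left sum_distrib_right mult.assoc) (subst sum.swap, simp)
  finally have "(\<Sum>x\<in>tabs. (\<Sum>\<sigma>\<in>H. \<chi> \<sigma> * \<phi> (permute_entries \<sigma> x)) * v x) \<noteq> 0"
    using \<phi>(2) by simp
  \<comment> \<open>A nonzero sum has a nonzero summand; its index is the required tableau.\<close>
  then obtain t where "t \<in> tabs" "(\<Sum>\<sigma>\<in>H. \<chi> \<sigma> * \<phi> (permute_entries \<sigma> t)) \<noteq> 0"
    by (metis (no_types, lifting) mult_zero_left sum.neutral)
  moreover have "garnir_function T \<mu> N \<phi>"
    by (rule garnir_function_of_functional) (rule \<phi>(1), simp add: \<pi>.ker_def)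
  ultimately show thesis using that by blast
qed

end

section \<open>Specht modules\<close>

lemma linear_rep_restrict:
  assumes "invariant_subspace n E W"
  shows "linear_rep n (restrict_rep E W)"
proof -
  interpret invariant_subspace n E W by fact
  have sub: "w \<in> carrier (rep_space E)" if "w \<in> W" for w
    using that W.subset by auto
  show ?thesis
    by (rule linear_rep.intro)
      (use V.submodule_is_module[OF submodule] in
        \<open>auto simp: restrict_rep_def invariant act_add act_smult act_inverse sub simp del: One_nat_def\<close>)
qed

text \<open>With this, sums formed in a subrepresentation are evaluated in the ambient
  space.\<close>

lemma inclusion_mod_hom:
  assumes "invariant_subspace n E W"
  shows "mod_hom CC (rep_space (restrict_rep E W)) (rep_space E) (\<lambda>w. w)"
proof -
  interpret invariant_subspace n E W by fact
  interpret R: linear_rep n "restrict_rep E W" using assms by (rule linear_rep_restrict)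
  have "(\<lambda>w. w) \<in> LinearCombinations.module_hom CC (rep_space (restrict_rep E W)) (rep_space E)"
    using W.subset by (auto simp: LinearCombinations.module_hom_def restrict_rep_def)
  then show ?thesis
    by (simp add: mod_hom_def mod_hom_axioms_def is_module R.is_module)
qed

section \<open>Young diagrams, tabloids and polytabloids\<close>

lemma young_diagram_Sigma: "young_diagram \<nu> = Sigma {..<length \<nu>} (\<lambda>i. {..<\<nu> ! i})"
  by (auto simp: young_diagram_def)

lemma finite_young_diagram: "finite (young_diagram \<nu>)"
  by (simp add: young_diagram_Sigma)

lemma card_young_diagram: "card (young_diagram \<nu>) = sum_list \<nu>"
  by (simp add: young_diagram_Sigma sum_list_sum_nth atLeast0LessThan)

text \<open>Row lengths weakly decrease, so the first row meets every column.\<close>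

lemma snd_young_diagram:
  assumes "sorted_wrt (\<ge>) \<nu>" "\<nu> \<noteq> []"
  shows "snd ` young_diagram \<nu> = {..<\<nu> ! 0}"
proof
  have "\<nu> ! i \<le> \<nu> ! 0" if "i < length \<nu>" for i
    using sorted_wrt_nth_less[OF assms(1), of 0 i] that by (cases i) auto
  then show "snd ` young_diagram \<nu> \<subseteq> {..<\<nu> ! 0}"
    by (fastforce simp: young_diagram_def)
  show "{..<\<nu> ! 0} \<subseteq> snd ` young_diagram \<nu>"
    using assms(2) by (force simp: young_diagram_def)
qed

lemma row_entries_comp: "row_entries \<nu> (\<sigma> \<circ> t) = (\<lambda>i. \<sigma> ` row_entries \<nu> t i)"
  by (auto simp: row_entries_def fun_eq_iff image_comp)

lemma column_entries_comp: "column_entries \<nu> (\<sigma> \<circ> t) j = \<sigma> ` column_entries \<nu> t j"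
  by (auto simp: column_entries_def image_comp)

lemma comp_young_tableaux:
  "\<sigma> permutes {1..n} \<Longrightarrow> t \<in> young_tableaux \<nu> n \<Longrightarrow> \<sigma> \<circ> t \<in> young_tableaux \<nu> n"
  unfolding young_tableaux_def using bij_betw_trans permutes_imp_bij by blast

lemma comp_young_tableaux_tabloids:
  "\<sigma> permutes {1..n} \<Longrightarrow> t \<in> young_tableaux \<nu> n \<Longrightarrow> row_entries \<nu> (\<sigma> \<circ> t) \<in> tabloids \<nu> n"
  unfolding tabloids_def using comp_young_tableaux by blast

global_interpretation tabloid: perm_action n "tabloids \<nu> n" "\<lambda>\<sigma> r i. \<sigma> ` r i" for \<nu> n
proof
  fix \<sigma> r assume \<sigma>: "\<sigma> permutes {1..n}" and "r \<in> tabloids \<nu> n"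
  then obtain t where t: "t \<in> young_tableaux \<nu> n" "r = row_entries \<nu> t"
    by (auto simp: tabloids_def)
  show "(\<lambda>i. \<sigma> ` r i) \<in> tabloids \<nu> n"
    using comp_young_tableaux_tabloids[OF \<sigma> t(1)] by (simp add: t(2) row_entries_comp)
  show "(\<lambda>i. inv_into UNIV \<sigma> ` \<sigma> ` r i) = r"
    using permutes_inj[OF \<sigma>] by (simp add: image_comp)
qed

lemma rep_space_tabloid: "rep_space (tabloid_rep \<nu> n) = ring.func_space CC (tabloids \<nu> n)"
  by (simp add: tabloid_rep_def perm_rep_def)

lemma finite_column_stabilizer: "finite (column_stabilizer \<nu> n t)"
  by (rule finite_subset[OF _ finite_permutations[of "{1..n}"]]) (auto simp: column_stabilizer_def)

lemma polytabloid_closed: "polytabloid \<nu> n t \<in> carrier (rep_space (tabloid_rep \<nu> n))"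
proof -
  interpret Module.module CC "ring.func_space CC (tabloids \<nu> n)" by (rule module_func_space)
  show ?thesis
    unfolding polytabloid_def rep_space_tabloid by (rule M.finsum_closed) auto
qed

lemma polytabloid_apply:
  assumes "r \<in> tabloids \<nu> n"
  shows "polytabloid \<nu> n t r =
    (\<Sum>\<sigma>\<in>column_stabilizer \<nu> n t. if r = row_entries \<nu> (\<sigma> \<circ> t) then of_int (sign \<sigma>) else 0)"
  unfolding polytabloid_def rep_space_tabloid using assms
  by (subst func_space_finsum) (auto simp: basis_vec_def intro!: sum.cong)

text \<open>The columns of \<open>\<tau> \<circ> t\<close> are the images under \<tau> of those of
  \<open>t\<close>, so the two stabilizers are conjugate by \<tau>.\<close>

lemma column_stabilizer_comp:
  assumes \<tau>: "\<tau> permutes {1..n}"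
  shows "bij_betw (\<lambda>\<sigma>. \<tau> \<circ> \<sigma> \<circ> inv_into UNIV \<tau>) (column_stabilizer \<nu> n t) (column_stabilizer \<nu> n (\<tau> \<circ> t))"
proof (rule bij_betw_byWitness[of _ "\<lambda>\<sigma>. inv_into UNIV \<tau> \<circ> \<sigma> \<circ> \<tau>"])
  note inv = permutes_inv[OF \<tau>] permutes_inv_o[OF \<tau>] permutes_inverses[OF \<tau>]
  have inv_image: "inv_into UNIV \<tau> ` \<tau> ` A = A" for A
    using permutes_inj[OF \<tau>] by (simp add: image_comp)
  show "\<forall>\<sigma>\<in>column_stabilizer \<nu> n t. inv_into UNIV \<tau> \<circ> (\<tau> \<circ> \<sigma> \<circ> inv_into UNIV \<tau>) \<circ> \<tau> = \<sigma>"
      "\<forall>\<sigma>\<in>column_stabilizer \<nu> n (\<tau> \<circ> t). \<tau> \<circ> (inv_into UNIV \<tau> \<circ> \<sigma> \<circ> \<tau>) \<circ> inv_into UNIV \<tau> = \<sigma>"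
    by (simp_all add: fun_eq_iff inv)
  have comp_image: "(f \<circ> g) ` A = f ` g ` A" for f g :: "nat \<Rightarrow> nat" and A
    by (simp add: image_comp)
  show "(\<lambda>\<sigma>. \<tau> \<circ> \<sigma> \<circ> inv_into UNIV \<tau>) ` column_stabilizer \<nu> n t \<subseteq> column_stabilizer \<nu> n (\<tau> \<circ> t)"
  proof (rule image_subsetI)
    fix \<sigma> assume \<sigma>: "\<sigma> \<in> column_stabilizer \<nu> n t"
    then have "\<tau> \<circ> \<sigma> \<circ> inv_into UNIV \<tau> permutes {1..n}"
      by (intro permutes_compose inv(1) \<tau>) (simp add: column_stabilizer_def)
    with \<sigma> show "\<tau> \<circ> \<sigma> \<circ> inv_into UNIV \<tau> \<in> column_stabilizer \<nu> n (\<tau> \<circ> t)"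
      by (simp only: column_stabilizer_def column_entries_comp mem_Collect_eq comp_image inv_image) simp
  qed
  show "(\<lambda>\<sigma>. inv_into UNIV \<tau> \<circ> \<sigma> \<circ> \<tau>) ` column_stabilizer \<nu> n (\<tau> \<circ> t) \<subseteq> column_stabilizer \<nu> n t"
  proof (rule image_subsetI)
    fix \<sigma> assume \<sigma>: "\<sigma> \<in> column_stabilizer \<nu> n (\<tau> \<circ> t)"
    then have "inv_into UNIV \<tau> \<circ> \<sigma> \<circ> \<tau> permutes {1..n}"
      by (intro permutes_compose inv(1) \<tau>) (simp add: column_stabilizer_def)
    with \<sigma> show "inv_into UNIV \<tau> \<circ> \<sigma> \<circ> \<tau> \<in> column_stabilizer \<nu> n t"
      by (simp only: column_stabilizer_def column_entries_comp mem_Collect_eq comp_image inv_image) simp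
  qed
qed

text \<open>Conjugation by \<tau> matches the terms of the two polytabloids and preserves
  signs.\<close>

lemma act_polytabloid:
  assumes \<tau>: "\<tau> permutes {1..n}" and t: "t \<in> young_tableaux \<nu> n"
  shows "rep_act (tabloid_rep \<nu> n) \<tau> (polytabloid \<nu> n t) = polytabloid \<nu> n (\<tau> \<circ> t)"
proof (rule PiE_ext)
  show "rep_act (tabloid_rep \<nu> n) \<tau> (polytabloid \<nu> n t) \<in> tabloids \<nu> n \<rightarrow>\<^sub>E UNIV"
    by (simp add: tabloid_rep_def perm_rep_def)
  show "polytabloid \<nu> n (\<tau> \<circ> t) \<in> tabloids \<nu> n \<rightarrow>\<^sub>E UNIV"
    using polytabloid_closed[of \<nu> n "\<tau> \<circ> t"] by (simp add: rep_space_tabloid)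
  fix r assume r: "r \<in> tabloids \<nu> n"
  let ?r = "\<lambda>i. inv_into UNIV \<tau> ` r i"
  have r': "?r \<in> tabloids \<nu> n" using tabloid.closed[OF permutes_inv[OF \<tau>] r] .
  have "rep_act (tabloid_rep \<nu> n) \<tau> (polytabloid \<nu> n t) r = polytabloid \<nu> n t ?r"
    using r by (simp add: tabloid_rep_def perm_rep_def)
  also have "\<dots> = (\<Sum>\<sigma>\<in>column_stabilizer \<nu> n t.
      if r = row_entries \<nu> (\<tau> \<circ> \<sigma> \<circ> inv_into UNIV \<tau> \<circ> (\<tau> \<circ> t))
      then of_int (sign (\<tau> \<circ> \<sigma> \<circ> inv_into UNIV \<tau>)) else 0)"
    unfolding polytabloid_apply[OF r']
  proof (rule sum.cong[OF refl])
    fix \<sigma> assume "\<sigma> \<in> column_stabilizer \<nu> n t"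
    then have \<sigma>: "\<sigma> permutes {1..n}" by (simp add: column_stabilizer_def)
    \<comment> \<open>The conjugate of \<sigma>, applied to the moved tableau, is the moved
      \<sigma>-translate of \<open>t\<close>.\<close>
    have "\<tau> \<circ> \<sigma> \<circ> inv_into UNIV \<tau> \<circ> (\<tau> \<circ> t) = \<tau> \<circ> (\<sigma> \<circ> t)"
      by (simp add: fun_eq_iff permutes_inverses[OF \<tau>])
    moreover have "?r = row_entries \<nu> (\<sigma> \<circ> t) \<longleftrightarrow> r = row_entries \<nu> (\<tau> \<circ> (\<sigma> \<circ> t))"
      using tabloid.inverse'[OF \<tau> r] tabloid.inverse[OF \<tau> comp_young_tableaux_tabloids[OF \<sigma> t]]
      unfolding row_entries_comp[of \<nu> \<tau>] by metis
    moreover have "sign (\<tau> \<circ> \<sigma> \<circ> inv_into UNIV \<tau>) = sign \<sigma>"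
    proof -
      have "permutation \<tau>" "permutation \<sigma>" "permutation (inv_into UNIV \<tau>)"
        using \<tau> \<sigma> permutes_inv[OF \<tau>] by (auto simp: permutation_permutes)
      then show ?thesis
        by (simp add: sign_compose permutation_compose sign_inverse)
    qed
    ultimately show "(if ?r = row_entries \<nu> (\<sigma> \<circ> t) then of_int (sign \<sigma>) else 0) =
        (if r = row_entries \<nu> (\<tau> \<circ> \<sigma> \<circ> inv_into UNIV \<tau> \<circ> (\<tau> \<circ> t))
         then of_int (sign (\<tau> \<circ> \<sigma> \<circ> inv_into UNIV \<tau>)) else (0 :: complex))"
      by simp
  qed
  also have "\<dots> = polytabloid \<nu> n (\<tau> \<circ> t) r"
    unfolding polytabloid_apply[OF r]
    by (rule sum.reindex_bij_betw[OF column_stabilizer_comp[OF \<tau>]])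
  finally show "rep_act (tabloid_rep \<nu> n) \<tau> (polytabloid \<nu> n t) r = polytabloid \<nu> n (\<tau> \<circ> t) r" .
qed

lemma invariant_subspace_specht:
  "invariant_subspace n (tabloid_rep \<nu> n)
    (vspan (rep_space (tabloid_rep \<nu> n)) (polytabloid \<nu> n ` young_tableaux \<nu> n))"
proof -
  interpret linear_rep n "tabloid_rep \<nu> n"
    unfolding tabloid_rep_def by (rule tabloid.linear_rep_axioms)
  have sub: "polytabloid \<nu> n ` young_tableaux \<nu> n \<subseteq> carrier (rep_space (tabloid_rep \<nu> n))"
    using polytabloid_closed by blast
  show ?thesis
  proof (intro invariant_subspace.intro invariant_subspace_axioms.intro linear_rep_axioms)
    show "submodule CC (vspan (rep_space (tabloid_rep \<nu> n)) (polytabloid \<nu> n ` young_tableaux \<nu> n))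
        (rep_space (tabloid_rep \<nu> n))"
      using sub by (rule V.span_is_submodule)
  next
    fix \<sigma> w assume \<sigma>: "\<sigma> permutes {1..n}"
      and w: "w \<in> vspan (rep_space (tabloid_rep \<nu> n)) (polytabloid \<nu> n ` young_tableaux \<nu> n)"
    show "rep_act (tabloid_rep \<nu> n) \<sigma> w \<in>
        vspan (rep_space (tabloid_rep \<nu> n)) (polytabloid \<nu> n ` young_tableaux \<nu> n)"
      using sub \<sigma> _ w
    proof (rule span_invariant)
      show "rep_act (tabloid_rep \<nu> n) \<sigma> v \<in> polytabloid \<nu> n ` young_tableaux \<nu> n"
        if "v \<in> polytabloid \<nu> n ` young_tableaux \<nu> n" for v
        using that act_polytabloid[OF \<sigma>] comp_young_tableaux[OF \<sigma>] by auto
    qed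
  qed
qed

lemma linear_rep_specht: "linear_rep n (specht \<nu> n)"
  unfolding specht_def by (rule linear_rep_restrict[OF invariant_subspace_specht])

lemma polytabloid_in_specht:
  assumes "t \<in> young_tableaux \<nu> n"
  shows "polytabloid \<nu> n t \<in> carrier (rep_space (specht \<nu> n))"
proof -
  interpret linear_rep n "tabloid_rep \<nu> n"
    unfolding tabloid_rep_def by (rule tabloid.linear_rep_axioms)
  show ?thesis
    using V.in_own_span[of "polytabloid \<nu> n ` young_tableaux \<nu> n"] polytabloid_closed assms
    by (auto simp: specht_def restrict_rep_def)
qed

text \<open>The sum in \<open>nz\<close> is the coefficient of the resulting vector at the tabloid
  of \<open>t\<close>; the inverse is the one by which \<open>perm_rep\<close> acts on
  functions.\<close>

lemma specht_group_algebra_nonzero: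
  assumes t: "t \<in> young_tableaux \<nu> n" and H: "\<And>\<sigma>. \<sigma> \<in> H \<Longrightarrow> \<sigma> permutes {1..n}"
    and nz: "(\<Sum>\<sigma>\<in>H. \<chi> \<sigma> * polytabloid \<nu> n t (row_entries \<nu> (inv_into UNIV \<sigma> \<circ> t))) \<noteq> 0"
  shows "(\<Oplus>\<^bsub>rep_space (specht \<nu> n)\<^esub> \<sigma> \<in> H.
      \<chi> \<sigma> \<odot>\<^bsub>rep_space (specht \<nu> n)\<^esub> rep_act (specht \<nu> n) \<sigma> (polytabloid \<nu> n t)) \<noteq>
    \<zero>\<^bsub>rep_space (specht \<nu> n)\<^esub>"
proof -
  interpret S: linear_rep n "specht \<nu> n" by (rule linear_rep_specht)
  let ?g = "\<lambda>\<sigma>. \<chi> \<sigma> \<odot>\<^bsub>rep_space (specht \<nu> n)\<^esub> rep_act (specht \<nu> n) \<sigma> (polytabloid \<nu> n t)"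
  have g: "?g \<in> H \<rightarrow> carrier (rep_space (specht \<nu> n))"
    using S.act_closed[OF H polytabloid_in_specht[OF t]] by auto
  have r: "row_entries \<nu> t \<in> tabloids \<nu> n" using t by (auto simp: tabloids_def)
  interpret incl: mod_hom CC "rep_space (specht \<nu> n)" "rep_space (tabloid_rep \<nu> n)" "\<lambda>w. w"
    unfolding specht_def by (rule inclusion_mod_hom[OF invariant_subspace_specht])
  have g': "?g \<in> H \<rightarrow> carrier (ring.func_space CC (tabloids \<nu> n))"
    using g incl.f_im by (auto simp: rep_space_tabloid)
  have "finsum (rep_space (specht \<nu> n)) ?g H (row_entries \<nu> t) =
      finsum (ring.func_space CC (tabloids \<nu> n)) ?g H (row_entries \<nu> t)"
    using mod_hom_finsum[OF incl.mod_hom_axioms g] by (simp add: rep_space_tabloid)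
  also have "\<dots> = (\<Sum>\<sigma>\<in>H. ?g \<sigma> (row_entries \<nu> t))"
    using g' r by (rule func_space_finsum)
  also have "\<dots> = (\<Sum>\<sigma>\<in>H. \<chi> \<sigma> * polytabloid \<nu> n t (row_entries \<nu> (inv_into UNIV \<sigma> \<circ> t)))"
    using r by (simp add: specht_def restrict_rep_def tabloid_rep_def perm_rep_def row_entries_comp)
  finally have "finsum (rep_space (specht \<nu> n)) ?g H (row_entries \<nu> t) \<noteq> 0" using nz by simp
  moreover have "\<zero>\<^bsub>rep_space (specht \<nu> n)\<^esub> (row_entries \<nu> t) = 0"
    using r by (simp add: specht_def restrict_rep_def rep_space_tabloid)
  ultimately show ?thesis by metis
qed

section \<open>Symmetrizers applied to the polytabloid of a fixed tableau\<close>

locale young_tableau =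
  fixes \<nu> :: "nat list" and n :: nat and t :: "nat \<times> nat \<Rightarrow> nat"
  assumes tableau: "t \<in> young_tableaux \<nu> n"
begin

lemma bij: "bij_betw t (young_diagram \<nu>) {1..n}"
  using tableau by (simp add: young_tableaux_def)

lemma inj: "c \<in> young_diagram \<nu> \<Longrightarrow> d \<in> young_diagram \<nu> \<Longrightarrow> t c = t d \<Longrightarrow> c = d"
  using bij by (auto simp: bij_betw_def dest: inj_onD)

lemma cell_of_entry:
  assumes "x \<in> {1..n}"
  obtains c where "c \<in> young_diagram \<nu>" "x = t c"
  using assms bij by (metis bij_betw_imp_surj_on imageE)

text \<open>This serves as the colouring of entries in \<open>alternating_sum_vanishes\<close>; its
  values are meaningful on \<open>{1..n}\<close>.\<close>

definition column_of :: "nat \<Rightarrow> nat" where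
  "column_of x = snd (inv_into (young_diagram \<nu>) t x)"

lemma column_of: "c \<in> young_diagram \<nu> \<Longrightarrow> column_of (t c) = snd c"
  using bij by (simp add: column_of_def bij_betw_def)

lemma column_entries_eq: "column_entries \<nu> t j = {x \<in> {1..n}. column_of x = j}"
proof -
  have "x \<in> column_entries \<nu> t j \<longleftrightarrow> x \<in> {1..n} \<and> column_of x = j" for x
  proof (cases "x \<in> {1..n}")
    case True
    then obtain c where "c \<in> young_diagram \<nu>" "x = t c" by (rule cell_of_entry)
    then show ?thesis using True by (auto simp: column_entries_def column_of dest: inj)
  next
    case False
    then show ?thesis using bij by (auto simp: column_entries_def bij_betw_def)
  qed
  then show ?thesis by auto
qed

lemma column_of_in: "x \<in> {1..n} \<Longrightarrow> column_of x \<in> snd ` young_diagram \<nu>"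
  by (metis cell_of_entry column_of imageI)

text \<open>A permutation preserving the colouring maps each column injectively into itself, hence
  onto itself by finiteness. This is the form of the group in
  \<open>alternating_sum_vanishes\<close>.\<close>

lemma column_stabilizer_eq:
  "column_stabilizer \<nu> n t = {\<sigma>. \<sigma> permutes {1..n} \<and> (\<forall>x\<in>{1..n}. column_of (\<sigma> x) = column_of x)}"
proof (rule equalityI; rule subsetI)
  fix \<sigma> assume "\<sigma> \<in> column_stabilizer \<nu> n t"
  then show "\<sigma> \<in> {\<sigma>. \<sigma> permutes {1..n} \<and> (\<forall>x\<in>{1..n}. column_of (\<sigma> x) = column_of x)}"
    unfolding column_stabilizer_def column_entries_eq by blast
next
  fix \<sigma> assume \<sigma>: "\<sigma> \<in> {\<sigma>. \<sigma> permutes {1..n} \<and> (\<forall>x\<in>{1..n}. column_of (\<sigma> x) = column_of x)}"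
  have "\<sigma> ` {x \<in> {1..n}. column_of x = j} = {x \<in> {1..n}. column_of x = j}" for j
  proof (rule endo_inj_surj)
    show "\<sigma> ` {x \<in> {1..n}. column_of x = j} \<subseteq> {x \<in> {1..n}. column_of x = j}"
      using \<sigma> permutes_in_image[of \<sigma> "{1..n}"] by auto
    show "inj_on \<sigma> {x \<in> {1..n}. column_of x = j}"
      using \<sigma> permutes_inj by (auto intro: inj_on_subset[OF _ subset_UNIV])
  qed simp
  then show "\<sigma> \<in> column_stabilizer \<nu> n t"
    using \<sigma> by (simp add: column_stabilizer_def column_entries_eq)
qed

text \<open>A cell is determined by its row and column. For \<open>x\<close> in cell
  \<open>c\<close>, the common tabloid puts the entry mapped to \<open>\<sigma> x\<close> by \<tau>
  in the row of \<open>c\<close>, and the column stabilizer puts it in the column of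
  \<open>c\<close>.\<close>

lemma rows_columns_determine:
  assumes "\<sigma> \<in> column_stabilizer \<nu> n t" "\<tau> \<in> column_stabilizer \<nu> n t"
    and rows: "row_entries \<nu> (\<sigma> \<circ> t) = row_entries \<nu> (\<tau> \<circ> t)"
  shows "\<sigma> = \<tau>"
proof
  have perm: "\<sigma> permutes {1..n}" "\<tau> permutes {1..n}"
    and cols: "\<And>j. \<sigma> ` column_entries \<nu> t j = column_entries \<nu> t j"
      "\<And>j. \<tau> ` column_entries \<nu> t j = column_entries \<nu> t j"
    using assms(1,2) by (auto simp: column_stabilizer_def)
  fix x
  show "\<sigma> x = \<tau> x"
  proof (cases "x \<in> {1..n}")
    case True
    then obtain c where c: "c \<in> young_diagram \<nu>" "x = t c" by (rule cell_of_entry)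
    have "\<sigma> x \<in> \<tau> ` row_entries \<nu> t (fst c)"
      using c fun_cong[OF rows, of "fst c"] by (auto simp: row_entries_comp row_entries_def)
    then obtain d where d: "d \<in> young_diagram \<nu>" "fst d = fst c" "\<sigma> x = \<tau> (t d)"
      by (auto simp: row_entries_def)
    have "x \<in> column_entries \<nu> t (snd c)" using c by (auto simp: column_entries_def)
    then have "\<sigma> x \<in> column_entries \<nu> t (snd c)"
      using cols(1)[of "snd c"] by blast
    then have "\<tau> (t d) \<in> \<tau> ` column_entries \<nu> t (snd c)"
      unfolding cols(2) d(3) .
    then have "t d \<in> column_entries \<nu> t (snd c)"
      using permutes_inj[OF perm(2)] by (simp add: inj_image_mem_iff)
    then have "snd d = snd c" using d(1) by (auto simp: column_entries_def dest: inj)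
    then have "d = c" using d(2) by (simp add: prod_eq_iff)
    then show ?thesis using c d by simp
  next
    case False
    then show ?thesis using perm by (simp add: permutes_not_in)
  qed
qed

text \<open>Distinct elements of the column stabilizer give distinct tabloids, so a single term of
  the polytabloid survives.\<close>

lemma polytabloid_coeff:
  assumes \<tau>: "\<tau> \<in> column_stabilizer \<nu> n t"
  shows "polytabloid \<nu> n t (row_entries \<nu> (\<tau> \<circ> t)) = of_int (sign \<tau>)"
proof -
  have "row_entries \<nu> (\<tau> \<circ> t) \<in> tabloids \<nu> n"
    using \<tau> by (intro comp_young_tableaux_tabloids tableau) (simp add: column_stabilizer_def)
  then have "polytabloid \<nu> n t (row_entries \<nu> (\<tau> \<circ> t)) =
      (\<Sum>\<sigma>\<in>column_stabilizer \<nu> n t.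
        if row_entries \<nu> (\<tau> \<circ> t) = row_entries \<nu> (\<sigma> \<circ> t) then of_int (sign \<sigma>) else 0)"
    by (rule polytabloid_apply)
  also have "\<dots> = (\<Sum>\<sigma>\<in>column_stabilizer \<nu> n t. if \<tau> = \<sigma> then of_int (sign \<sigma>) else 0)"
    using rows_columns_determine[OF \<tau>] by (intro sum.cong) auto
  also have "\<dots> = of_int (sign \<tau>)"
    using \<tau> by (simp add: finite_column_stabilizer)
  finally show ?thesis .
qed

lemma id_in_column_stabilizer: "id \<in> column_stabilizer \<nu> n t"
  by (simp add: column_stabilizer_def permutes_id)

lemma inv_in_column_stabilizer:
  assumes "\<sigma> \<in> column_stabilizer \<nu> n t"
  shows "inv_into UNIV \<sigma> \<in> column_stabilizer \<nu> n t"
proof -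
  have \<sigma>: "\<sigma> permutes {1..n}" "\<And>j. \<sigma> ` column_entries \<nu> t j = column_entries \<nu> t j"
    using assms by (auto simp: column_stabilizer_def)
  have "inv_into UNIV \<sigma> ` column_entries \<nu> t j = column_entries \<nu> t j" for j
    using \<sigma>(2)[of j] permutes_inj[OF \<sigma>(1)] by (metis image_inv_f_f)
  then show ?thesis using permutes_inv[OF \<sigma>(1)] by (simp add: column_stabilizer_def)
qed

text \<open>Each summand is a sign times the sign of the inverse, that is 1; the sum is the order of
  the column stabilizer.\<close>

lemma column_antisymmetrizer_nonzero:
  "(\<Sum>\<sigma>\<in>column_stabilizer \<nu> n t.
    of_int (sign \<sigma>) * polytabloid \<nu> n t (row_entries \<nu> (inv_into UNIV \<sigma> \<circ> t))) \<noteq> 0"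
proof -
  have "of_int (sign \<sigma>) * polytabloid \<nu> n t (row_entries \<nu> (inv_into UNIV \<sigma> \<circ> t)) = 1"
    if "\<sigma> \<in> column_stabilizer \<nu> n t" for \<sigma>
  proof -
    have "permutation \<sigma>"
      using that by (auto simp: column_stabilizer_def permutation_permutes)
    then show ?thesis
      unfolding polytabloid_coeff[OF inv_in_column_stabilizer[OF that]]
      by (simp add: sign_inverse flip: of_int_mult)
  qed
  then show ?thesis
    using finite_column_stabilizer id_in_column_stabilizer by (auto simp: card_eq_0_iff)
qed

definition row_stabilizer :: "(nat \<Rightarrow> nat) set" where
  "row_stabilizer = {\<sigma>. \<sigma> permutes {1..n} \<and> (\<forall>i. \<sigma> ` row_entries \<nu> t i = row_entries \<nu> t i)}"

text \<open>Row permutations fix the tabloid of \<open>t\<close>, whose coefficient is 1, so the sum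
  is the order of the row stabilizer. The factor 1 is the trivial character in the role of
  \<chi>.\<close>

lemma row_symmetrizer_nonzero:
  "(\<Sum>\<sigma>\<in>row_stabilizer. 1 * polytabloid \<nu> n t (row_entries \<nu> (inv_into UNIV \<sigma> \<circ> t))) \<noteq> 0"
proof -
  have "polytabloid \<nu> n t (row_entries \<nu> (inv_into UNIV \<sigma> \<circ> t)) = 1"
    if "\<sigma> \<in> row_stabilizer" for \<sigma>
  proof -
    have \<sigma>: "\<sigma> permutes {1..n}" "\<And>i. \<sigma> ` row_entries \<nu> t i = row_entries \<nu> t i"
      using that by (auto simp: row_stabilizer_def)
    have "inv_into UNIV \<sigma> ` row_entries \<nu> t i = row_entries \<nu> t i" for i
      using \<sigma>(2)[of i] permutes_inj[OF \<sigma>(1)] by (metis image_inv_f_f)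
    then have "row_entries \<nu> (inv_into UNIV \<sigma> \<circ> t) = row_entries \<nu> (id \<circ> t)"
      by (simp add: row_entries_comp)
    then show ?thesis using polytabloid_coeff[OF id_in_column_stabilizer] by simp
  qed
  moreover have "finite row_stabilizer"
    by (rule finite_subset[OF _ finite_permutations[of "{1..n}"]]) (auto simp: row_stabilizer_def)
  moreover have "id \<in> row_stabilizer" by (simp add: row_stabilizer_def permutes_id)
  ultimately show ?thesis by (auto simp: card_eq_0_iff)
qed

text \<open>This supplies the closure condition of \<open>symmetric_sum_vanishes\<close>, with a row
  as the set \<open>S\<close>.\<close>

lemma row_stabilizer_transpose:
  assumes \<sigma>: "\<sigma> \<in> row_stabilizer" and x: "x \<in> row_entries \<nu> t i" and y: "y \<in> row_entries \<nu> t i"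
  shows "\<sigma> \<circ> Transposition.transpose x y \<in> row_stabilizer"
proof -
  have xy: "x \<in> {1..n}" "y \<in> {1..n}"
    using x y bij by (auto simp: row_entries_def bij_betw_def)
  have "Transposition.transpose x y ` row_entries \<nu> t k = row_entries \<nu> t k" for k
  proof (cases "k = i")
    case True
    then show ?thesis using x y by (simp add: transpose_image_eq)
  next
    case False
    then have "x \<notin> row_entries \<nu> t k" "y \<notin> row_entries \<nu> t k"
      using x y by (auto simp: row_entries_def dest: inj)
    then show ?thesis by (simp add: transpose_image_eq)
  qed
  then have "(\<sigma> \<circ> Transposition.transpose x y) ` row_entries \<nu> t k = row_entries \<nu> t k" for k
    using \<sigma> unfolding image_comp[symmetric] by (simp add: row_stabilizer_def)
  then show ?thesis
    using \<sigma> permutes_compose[OF transpose_permutes[OF xy], of \<sigma>] unfolding row_stabilizer_def by blast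
qed

lemma card_row_entries:
  assumes "i < length \<nu>"
  shows "card (row_entries \<nu> t i) = \<nu> ! i"
proof -
  have "{c \<in> young_diagram \<nu>. fst c = i} = Pair i ` {..<\<nu> ! i}"
    using assms by (auto simp: young_diagram_def)
  moreover have "inj_on t {c \<in> young_diagram \<nu>. fst c = i}"
    using bij by (auto simp: bij_betw_def intro: inj_on_subset)
  ultimately show ?thesis
    by (simp add: row_entries_def card_image inj_on_def)
qed

end

section \<open>Comparing the number of columns with the number of nodes\<close>

theorem theorem6p4:
  fixes T :: plane_tree and \<mu> :: "nat list \<Rightarrow> nat" and N :: nat and \<nu> :: "nat list"
  assumes "tree_partition T \<mu> N"
    and "is_partition \<nu> N"
    and "contained_in N (specht \<nu> N) (tree_specht T \<mu> N)"
  shows "num_columns \<nu> = card (nodes T)"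
proof -
  interpret tree_shape T \<mu> N using assms(1) by unfold_locales
  have "card (young_diagram \<nu>) = card {1..N}"
    using assms(2) by (simp add: is_partition_def card_young_diagram)
  then obtain t where "bij_betw t (young_diagram \<nu>) {1..N}"
    using finite_same_card_bij[OF finite_young_diagram] by blast
  then interpret young_tableau \<nu> N t
    by unfold_locales (simp add: young_tableaux_def)
  \<comment> \<open>The label of the root is positive. Hence \<nu> is nonempty and its first row
    counts the columns.\<close>
  have "0 < N"
    using assms(1) sum_pos[OF finite_nodes, of T \<mu>] Nil_in_nodes[of T] unfolding tree_partition_def by blast
  then have "\<nu> \<noteq> []" using assms(2) by (auto simp: is_partition_def)
  then have cols: "snd ` young_diagram \<nu> = {..<\<nu> ! 0}"
    using assms(2) by (intro snd_young_diagram) (auto simp: is_partition_def)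
  then have num: "num_columns \<nu> = \<nu> ! 0" by (simp add: num_columns_def)
  have "\<not> num_columns \<nu> < card (nodes T)"
  proof
    assume less: "num_columns \<nu> < card (nodes T)"
    obtain F s where F: "garnir_function T \<mu> N F" and s: "s \<in> tabs"
      and nz: "(\<Sum>\<sigma>\<in>column_stabilizer \<nu> N t. of_int (sign \<sigma>) * F (permute_entries \<sigma> s)) \<noteq> 0"
      by (rule detecting_garnir_function[OF linear_rep_specht assms(3) polytabloid_in_specht[OF tableau] _
            specht_group_algebra_nonzero[OF tableau _ column_antisymmetrizer_nonzero]])
        (auto simp: column_stabilizer_def)
    \<comment> \<open>The columns of the diagram are the colours, numbered from 0.\<close>
    have "column_of x < num_columns \<nu>" if "x \<in> {1..N}" for x
      using column_of_in[OF that] by (simp add: cols num)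
    from garnir_function.alternating_sum_vanishes[where c = column_of, OF F less this s] nz
    show False by (simp add: column_stabilizer_eq)
  qed
  moreover have "\<not> card (nodes T) < num_columns \<nu>"
  proof
    assume less: "card (nodes T) < num_columns \<nu>"
    obtain F s where F: "garnir_function T \<mu> N F" and s: "s \<in> tabs"
      and nz: "(\<Sum>\<sigma>\<in>row_stabilizer. 1 * F (permute_entries \<sigma> s)) \<noteq> 0"
      by (rule detecting_garnir_function[OF linear_rep_specht assms(3) polytabloid_in_specht[OF tableau] _
            specht_group_algebra_nonzero[OF tableau _ row_symmetrizer_nonzero]])
        (auto simp: row_stabilizer_def)
    have row: "row_entries \<nu> t 0 \<subseteq> {1..N}"
      using bij by (auto simp: row_entries_def bij_betw_def)
    \<comment> \<open>The first row has one entry per column, more than there are nodes, as the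
      pigeonhole argument requires.\<close>
    have card: "card (nodes T) < card (row_entries \<nu> t 0)"
      using less \<open>\<nu> \<noteq> []\<close> by (simp add: card_row_entries num)
    have "(\<Sum>\<sigma>\<in>row_stabilizer. F (permute_entries \<sigma> s)) = 0"
    proof (rule garnir_function.symmetric_sum_vanishes[OF F row card s])
      show "\<sigma> permutes {1..N}" if "\<sigma> \<in> row_stabilizer" for \<sigma>
        using that by (simp add: row_stabilizer_def)
    qed (rule row_stabilizer_transpose)
    with nz show False by simp
  qed
  ultimately show ?thesis by linarith
qed

end
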